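(* Let $\phi$ be a finite Blaschke product of order $n>1$. Then $M_\phi$ is unitarily equivalent to $M_{z^n}$ on the Dirichlet space $D$ if and only if $\phi=az^n$ for some $a\in\mathbb{C}$ with $|a|=1$.
   Context: $\mathbb{D}=\{z\in\mathbb{C}:|z|<1\}$ and $dA$ is normalized Lebesgue area measure on $\mathbb{D}$. The Dirichlet space $D$ is the Hilbert space of holomorphic $f$ on $\mathbb{D}$ with $\int_{\mathbb{D}}|f'|^2dA<\infty$, with norm $\|f\|_D^2=\|f\|_{H^2}^2+\int_{\mathbb{D}}|f'|^2dA=\sum_{n\ge 0}(n+1)|\hat f(n)|^2$, where $\hat f(n)$ is the $n$-th Taylor coefficient and $H^2$ is the Hardy space. For $\lambda\in\mathbb{D}$, $\varphi_\lambda(z)=\frac{\lambda-z}{1-\overline{\lambda}z}$. A finite Blaschke product of order $n\ge1$ is a function $c\,\varphi_{\lambda_1}\cdots\varphi_{\lambda_n}$ with $\lambda_1,\dots,\lambda_n\in\mathbb{D}$ (not necessarily distinct) and $|c|=1$. $M_\phi f=\phi f$ is then a bounded operator on $D$. Operators $S,T$ on $D$ are unitarily equivalent if there is a unitary operator $U$ on $D$ with $U^*SU=T$. *)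

theory Defs
  imports "HOL-Complex_Analysis.Complex_Analysis"
begin

abbreviation unit_disc :: "complex set" where
  "unit_disc \<equiv> ball 0 1"

definition taylor_coeff :: "(complex \<Rightarrow> complex) \<Rightarrow> nat \<Rightarrow> complex" where
  "taylor_coeff f k = (deriv ^^ k) f 0 / fact k"

text \<open>A function on the disc is represented by its extension by zero to the whole plane, so that
  equality in the space is equality of HOL functions and the pointwise vector space operations
  stay in the space.\<close>

definition dirichlet_space :: "(complex \<Rightarrow> complex) set" where
  "dirichlet_space = {f. f holomorphic_on unit_disc \<and> (\<forall>z. z \<notin> unit_disc \<longrightarrow> f z = 0) \<and>
     set_integrable lborel unit_disc (\<lambda>z. (cmod (deriv f z))\<^sup>2)}"

definition hardy_inner :: "(complex \<Rightarrow> complex) \<Rightarrow> (complex \<Rightarrow> complex) \<Rightarrow> complex" where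
  "hardy_inner f g = (\<Sum>k. taylor_coeff f k * cnj (taylor_coeff g k))"

text \<open>This polarizes the squared norm: squared Hardy norm of \<open>f\<close> plus the integral of
  \<open>\<bar>f'\<bar>\<^sup>2\<close>. The factor \<open>1 / pi\<close> normalizes the area of the disc to 1.\<close>

definition dirichlet_inner :: "(complex \<Rightarrow> complex) \<Rightarrow> (complex \<Rightarrow> complex) \<Rightarrow> complex" where
  "dirichlet_inner f g = hardy_inner f g +
     complex_of_real (1 / pi) * (LINT z:unit_disc|lborel. deriv f z * cnj (deriv g z))"

definition dirichlet_norm :: "(complex \<Rightarrow> complex) \<Rightarrow> real" where
  "dirichlet_norm f = sqrt (Re (dirichlet_inner f f))"

text \<open>Operators are maps on all HOL functions; only their values on the Dirichlet space matter.\<close>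

definition dirichlet_operator :: "((complex \<Rightarrow> complex) \<Rightarrow> (complex \<Rightarrow> complex)) \<Rightarrow> bool" where
  "dirichlet_operator S \<longleftrightarrow>
     (\<forall>f\<in>dirichlet_space. S f \<in> dirichlet_space) \<and>
     (\<forall>f\<in>dirichlet_space. \<forall>g\<in>dirichlet_space. S (\<lambda>z. f z + g z) = (\<lambda>z. S f z + S g z)) \<and>
     (\<forall>c. \<forall>f\<in>dirichlet_space. S (\<lambda>z. c * f z) = (\<lambda>z. c * S f z)) \<and>
     (\<exists>K. \<forall>f\<in>dirichlet_space. dirichlet_norm (S f) \<le> K * dirichlet_norm f)"

definition dirichlet_adjoint ::
  "((complex \<Rightarrow> complex) \<Rightarrow> (complex \<Rightarrow> complex)) \<Rightarrow> ((complex \<Rightarrow> complex) \<Rightarrow> (complex \<Rightarrow> complex)) \<Rightarrow> bool" where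
  "dirichlet_adjoint S S' \<longleftrightarrow> dirichlet_operator S \<and> dirichlet_operator S' \<and>
     (\<forall>f\<in>dirichlet_space. \<forall>g\<in>dirichlet_space. dirichlet_inner (S f) g = dirichlet_inner f (S' g))"

text \<open>Below \<open>U'\<close> is the adjoint of \<open>U\<close>; the two inverse laws say that \<open>U\<close> is unitary.\<close>

definition unitarily_equivalent ::
  "((complex \<Rightarrow> complex) \<Rightarrow> (complex \<Rightarrow> complex)) \<Rightarrow> ((complex \<Rightarrow> complex) \<Rightarrow> (complex \<Rightarrow> complex)) \<Rightarrow> bool" where
  "unitarily_equivalent S T \<longleftrightarrow> (\<exists>U U'. dirichlet_adjoint U U' \<and>
     (\<forall>f\<in>dirichlet_space. U' (U f) = f) \<and>
     (\<forall>f\<in>dirichlet_space. U (U' f) = f) \<and>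
     (\<forall>f\<in>dirichlet_space. U' (S (U f)) = T f))"

definition mult_op :: "(complex \<Rightarrow> complex) \<Rightarrow> (complex \<Rightarrow> complex) \<Rightarrow> (complex \<Rightarrow> complex)" where
  "mult_op \<phi> f = (\<lambda>z. \<phi> z * f z)"

definition blaschke_factor :: "complex \<Rightarrow> complex \<Rightarrow> complex" where
  "blaschke_factor l z = (l - z) / (1 - cnj l * z)"

text \<open>A list of zeros allows repetitions; nothing is required of \<open>\<phi>\<close> off the disc.\<close>

definition finite_blaschke_product :: "nat \<Rightarrow> (complex \<Rightarrow> complex) \<Rightarrow> bool" where
  "finite_blaschke_product n \<phi> \<longleftrightarrow> n \<ge> 1 \<and>
     (\<exists>c ls. cmod c = 1 \<and> length ls = n \<and> set ls \<subseteq> unit_disc \<and>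
        (\<forall>z\<in>unit_disc. \<phi> z = c * (\<Prod>l\<leftarrow>ls. blaschke_factor l z)))"

end

theory Submission
  imports Defs
begin

text \<open>
  Write \<open>\<langle>f, g\<rangle>\<close> for the inner product of the Dirichlet space. In Taylor coefficients it is
  \<open>\<Sum>k. (k + 1) * f\<^sub>k * cnj g\<^sub>k\<close> (\<open>dirichlet_inner_sums\<close>), so multiplication by \<open>z ^ n\<close> changes it by
  exactly \<open>n\<close> times the Hardy inner product:
  \<open>\<langle>z ^ n * f, z ^ n * g\<rangle> = \<langle>f, g\<rangle> + n * (\<Sum>k. f\<^sub>k * cnj g\<^sub>k)\<close>.

  Suppose a unitary \<open>U\<close> intertwines multiplication by \<open>\<phi>\<close> with multiplication by \<open>z ^ n\<close>, and let
  \<open>g\<^sub>j\<close> be the image of \<open>z ^ j\<close> under the inverse of \<open>U\<close>. Then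
  \<open>\<langle>\<phi> * z ^ i, \<phi> * z ^ j\<rangle> = \<langle>z ^ n * g\<^sub>i, z ^ n * g\<^sub>j\<rangle>\<close> and \<open>\<langle>z ^ i, z ^ j\<rangle> = \<langle>g\<^sub>i, g\<^sub>j\<rangle>\<close>. The squared norm
  of a Blaschke product of order \<open>n\<close> is \<open>1 + n\<close>, since its boundary values are unimodular and its
  Dirichlet integral counts its zeros. Hence \<open>g\<^sub>0\<close> has both Dirichlet norm and Hardy norm 1, and
  since the weight \<open>k + 1\<close> exceeds 1 for \<open>k \<ge> 1\<close>, this forces \<open>g\<^sub>0\<close> to be constant. On pairs
  containing a constant the two inner products are proportional, so for \<open>j \<ge> 1\<close> the orthogonality
  of \<open>g\<^sub>j\<close> and \<open>g\<^sub>0\<close> makes \<open>\<langle>\<phi> * z ^ j, \<phi>\<rangle>\<close> vanish as well.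

  On the other hand, for \<open>j \<ge> 1\<close>, \<open>\<langle>\<phi> * z ^ j, \<phi>\<rangle>\<close> is the contour integral of \<open>z ^ j * \<phi>' / \<phi>\<close>
  over the unit circle divided by \<open>2 * pi * \<i>\<close>, that is, the power sum \<open>\<Sum>\<lambda> ^ j\<close> over the zeros \<open>\<lambda>\<close>
  of \<open>\<phi>\<close> (\<open>blaschke_product_inner_sums\<close>). If all these power sums vanish
  then every zero is 0 (\<open>power_sums_eq_0_imp_zeros\<close>), and \<open>\<phi>\<close> is a unimodular
  multiple of \<open>z ^ n\<close>. Conversely, if \<open>\<phi> = w ^ n * z ^ n\<close> with \<open>\<bar>w\<bar> = 1\<close>, the rotation
  \<open>f \<mapsto> f (w * z)\<close> is a unitary that intertwines the two operators.
\<close>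

unbundle no fps_syntax

section \<open>Area integrals of monomials\<close>

lemma prod_Basis_complex: "(\<Prod>b\<in>Basis. (f::complex \<Rightarrow> real) b) = f 1 * f \<i>"
  by (simp add: Basis_complex_def)

text \<open>Through these coordinates, orthogonal maps of \<open>real ^ 2\<close> yield measure-preserving maps of the
  complex plane.\<close>

lemma lborel_vec2_to_complex:
  "distr (lborel :: (real^2) measure) borel (\<lambda>v. Complex (v $ 1) (v $ 2)) = lborel"
proof (rule lborel_eqI[symmetric])
  have cont: "continuous_on UNIV (\<lambda>v :: real^2. Complex (v $ 1) (v $ 2))"
    unfolding Complex_eq by (intro continuous_intros)
  have meas: "(\<lambda>v :: real^2. Complex (v $ 1) (v $ 2)) \<in> borel_measurable borel"
    by (rule borel_measurable_continuous_onI[OF cont])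
  fix l u :: complex
  assume le: "\<And>b. b \<in> Basis \<Longrightarrow> l \<bullet> b \<le> u \<bullet> b"
  have le': "Re l \<le> Re u" "Im l \<le> Im u"
    using le[of 1] le[of \<i>] by (auto simp: Basis_complex_def)
  have pre: "(\<lambda>v :: real^2. Complex (v $ 1) (v $ 2)) -` box l u = box (vector [Re l, Im l]) (vector [Re u, Im u])"
    by (auto simp: mem_box_cart in_box_complex_iff forall_2)
  have Basis2: "(Basis :: (real^2) set) = {axis 1 1, axis 2 1}"
    by (auto simp: Basis_vec_def UNIV_2)
  have "axis 1 1 \<noteq> (axis 2 1 :: real^2)" by (simp add: axis_eq_axis)
  then have prod2: "(\<Prod>b\<in>Basis. ((vector [Re u, Im u] :: real^2) - vector [Re l, Im l]) \<bullet> b)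
      = (Re u - Re l) * (Im u - Im l)"
    by (simp add: Basis2 inner_axis)
  have "emeasure (distr (lborel :: (real^2) measure) borel (\<lambda>v. Complex (v $ 1) (v $ 2))) (box l u)
      = emeasure lborel (box (vector [Re l, Im l]) (vector [Re u, Im u]) :: (real^2) set)"
    using meas by (subst emeasure_distr) (auto simp: pre)
  also have "\<dots> = ennreal (\<Prod>b\<in>Basis. ((vector [Re u, Im u] :: real^2) - vector [Re l, Im l]) \<bullet> b)"
  proof (rule emeasure_lborel_box)
    fix b :: "real^2"
    assume "b \<in> Basis"
    then consider "b = axis 1 1" | "b = axis 2 1" unfolding Basis2 by blast
    then show "vector [Re l, Im l] \<bullet> b \<le> vector [Re u, Im u] \<bullet> b"
      using le' by cases (simp_all add: inner_axis)
  qed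
  finally show "emeasure (distr (lborel :: (real^2) measure) borel (\<lambda>v. Complex (v $ 1) (v $ 2))) (box l u)
      = (\<Prod>b\<in>Basis. (u - l) \<bullet> b)"
    by (simp add: prod2 prod_Basis_complex)
qed simp

lemma lborel_distr_orthogonal_vec:
  fixes f :: "real^'n::{finite,wellorder} \<Rightarrow> real^'n::_"
  assumes f: "orthogonal_transformation f"
  shows "distr lborel borel f = lborel"
proof (rule lborel_eqI[symmetric])
  have meas: "f \<in> borel_measurable borel"
    using orthogonal_transformation_linear[OF f] linear_continuous_on linear_conv_bounded_linear
    by (blast intro: borel_measurable_continuous_onI)
  fix l u :: "real^'n::_"
  assume le: "\<And>b. b \<in> Basis \<Longrightarrow> l \<bullet> b \<le> u \<bullet> b"
  have pre: "f -` box l u = inv f ` box l u"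
    using orthogonal_transformation_bij[OF f] by (simp add: bij_vimage_eq_inv_image)
  have lm: "f -` box l u \<in> lmeasurable"
    unfolding pre by (rule measurable_orthogonal_image) (use orthogonal_transformation_inv[OF f] in auto)
  have "emeasure (distr lborel borel f) (box l u) = emeasure lborel (f -` box l u)"
    using meas by (subst emeasure_distr) auto
  also have "\<dots> = emeasure lebesgue (f -` box l u)"
    using measurable_sets_borel[OF meas, of "box l u"] by (simp add: emeasure_completion)
  also have "\<dots> = measure lebesgue (f -` box l u)"
    by (rule emeasure_eq_measure2[OF lm])
  also have "\<dots> = measure lebesgue (box l u)"
    unfolding pre using measure_orthogonal_image[OF orthogonal_transformation_inv[OF f], of "box l u"]
    by simp
  finally show "emeasure (distr lborel borel f) (box l u) = (\<Prod>b\<in>Basis. (u - l) \<bullet> b)"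
    using le by (simp add: measure_completion measure_lborel_box)
qed simp

text \<open>In the coordinates of \<open>real ^ 2\<close> multiplication by a unimodular number is an orthogonal map.\<close>

lemma lborel_distr_rotation:
  assumes w: "cmod w = 1"
  shows "distr lborel borel (\<lambda>z. w * z) = lborel"
proof -
  define S where "S = (\<lambda>v :: real^2. Complex (v $ 1) (v $ 2))"
  define R :: "real^2 \<Rightarrow> real^2"
    where "R = (\<lambda>v. vector [Re w * v $ 1 - Im w * v $ 2, Re w * v $ 2 + Im w * v $ 1])"
  have w2: "(Re w)\<^sup>2 + (Im w)\<^sup>2 = 1"
    using w by (simp add: cmod_def)
  have lin: "linear R"
    by (rule linearI) (simp_all add: R_def vec_eq_iff forall_2 algebra_simps)
  have "R v \<bullet> R v' = v \<bullet> v'" for v v'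
  proof -
    have "R v \<bullet> R v' = ((Re w)\<^sup>2 + (Im w)\<^sup>2) * (v \<bullet> v')"
      by (simp add: R_def inner_vec_def sum_2 power2_eq_square algebra_simps)
    then show ?thesis by (simp add: w2)
  qed
  then have R: "orthogonal_transformation R"
    using lin by (simp add: orthogonal_transformation_def)
  have S_meas: "S \<in> borel_measurable borel"
    unfolding S_def Complex_eq by (intro borel_measurable_continuous_onI continuous_intros)
  have R_meas: "R \<in> borel_measurable borel"
    using lin linear_continuous_on linear_conv_bounded_linear
    by (blast intro: borel_measurable_continuous_onI)
  have w_meas: "(\<lambda>z. w * z) \<in> borel_measurable borel" by simp
  have comm: "(\<lambda>z. w * z) \<circ> S = S \<circ> R"
    by (intro ext complex_eqI) (simp_all add: S_def R_def)
  have "distr lborel borel (\<lambda>z. w * z) = distr (distr lborel borel S) borel (\<lambda>z. w * z)"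
    using lborel_vec2_to_complex by (simp add: S_def)
  also have "\<dots> = distr lborel borel ((\<lambda>z. w * z) \<circ> S)"
    using S_meas w_meas by (intro distr_distr) auto
  also have "\<dots> = distr lborel borel (S \<circ> R)"
    by (simp only: comm)
  also have "\<dots> = distr (distr lborel borel R) borel S"
    using S_meas R_meas by (intro distr_distr[symmetric]) auto
  also have "\<dots> = lborel"
    using lborel_distr_orthogonal_vec[OF R] lborel_vec2_to_complex by (simp add: S_def)
  finally show ?thesis .
qed

lemma measure_ball_complex:
  assumes "r \<ge> 0"
  shows "measure lborel (ball (0::complex) r) = pi * r\<^sup>2"
  using assms content_ball[of r "0::complex"] by (simp add: unit_ball_vol_2)

lemma set_integrable_continuous_ball:
  fixes f :: "complex \<Rightarrow> 'a::{banach, second_countable_topology}"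
  assumes "continuous_on (cball 0 r) f"
  shows "set_integrable lborel (ball 0 r) f"
proof (rule set_integrable_subset)
  show "set_integrable lborel (cball 0 r) f"
    unfolding set_integrable_def by (rule borel_integrable_compact) (use assms in auto)
qed auto

text \<open>As a function of the squared radius \<open>s\<close>, the integral has derivative \<open>pi * s ^ k\<close>: the annulus
  between the squared radii \<open>s\<close> and \<open>t\<close> has area \<open>pi * (t - s)\<close>, and on it the integrand lies
  between \<open>s ^ k\<close> and \<open>t ^ k\<close>.\<close>

lemma radial_moment:
  assumes "s \<ge> 0"
  shows "(LINT z:ball (0::complex) (sqrt s)|lborel. cmod z ^ (2 * k)) = pi * s ^ Suc k / (k + 1)"
proof -
  define G where "G s = (LINT z:ball (0::complex) (sqrt s)|lborel. cmod z ^ (2 * k))" for s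
  define D where "D s = G s - pi * s ^ Suc k / (k + 1)" for s
  have int: "set_integrable lborel (ball (0::complex) r) (\<lambda>z. cmod z ^ (2 * k))" for r
    by (intro set_integrable_continuous_ball continuous_intros)
  have annulus: "pi * s ^ k * (t - s) \<le> G t - G s \<and> G t - G s \<le> pi * t ^ k * (t - s)"
    if "0 \<le> s" "s \<le> t" for s t
  proof -
    let ?A = "ball (0::complex) (sqrt t) - ball 0 (sqrt s)"
    have sub: "ball (0::complex) (sqrt s) \<subseteq> ball 0 (sqrt t)"
      using that by (intro subset_ball) auto
    have intA: "set_integrable lborel ?A (\<lambda>z. cmod z ^ (2 * k))"
      by (rule set_integrable_subset[OF int]) auto
    have fin: "emeasure lborel (ball (0::complex) r) < \<infinity>" for r
      by (rule emeasure_bounded_finite) auto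
    have "ball (0::complex) (sqrt t) = ball 0 (sqrt s) \<union> ?A" using sub by auto
    then have "G t = (LINT z:ball (0::complex) (sqrt s) \<union> ?A|lborel. cmod z ^ (2 * k))"
      by (simp add: G_def)
    also have "\<dots> = G s + (LINT z:?A|lborel. cmod z ^ (2 * k))"
      unfolding G_def by (rule set_integral_Un) (use int intA in auto)
    finally have GG: "G t - G s = (LINT z:?A|lborel. cmod z ^ (2 * k))" by simp
    have mA: "measure lborel ?A = pi * (t - s)"
      using that sub fin[THEN less_imp_neq]
      by (subst measure_Diff) (auto simp: measure_ball_complex algebra_simps)
    have finA: "emeasure lborel ?A < \<infinity>"
      by (rule emeasure_bounded_finite) (auto intro: bounded_subset)
    have const: "set_integrable lborel ?A (\<lambda>z. c)" "(LINT z:?A|lborel. c) = c * (pi * (t - s))" for c :: real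
      using finA mA by (auto simp: set_integrable_def set_lebesgue_integral_def)
    have pw: "s ^ k \<le> cmod z ^ (2 * k)" "cmod z ^ (2 * k) \<le> t ^ k" if "z \<in> ?A" for z
    proof -
      have "sqrt s \<le> cmod z" "cmod z \<le> sqrt t" using that by auto
      moreover have "(cmod z)\<^sup>2 \<le> (sqrt t)\<^sup>2"
        by (rule power_mono) (use \<open>cmod z \<le> sqrt t\<close> in auto)
      ultimately have "s \<le> (cmod z)\<^sup>2" "(cmod z)\<^sup>2 \<le> t"
        using \<open>0 \<le> s\<close> \<open>s \<le> t\<close> sqrt_le_D by auto
      then show "s ^ k \<le> cmod z ^ (2 * k)" "cmod z ^ (2 * k) \<le> t ^ k"
        using \<open>0 \<le> s\<close> by (auto simp: power_mult intro: power_mono)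
    qed
    have "(LINT z:?A|lborel. s ^ k) \<le> (LINT z:?A|lborel. cmod z ^ (2 * k))"
      by (rule set_integral_mono) (use const intA pw in auto)
    moreover have "(LINT z:?A|lborel. cmod z ^ (2 * k)) \<le> (LINT z:?A|lborel. t ^ k)"
      by (rule set_integral_mono) (use const intA pw in auto)
    ultimately show ?thesis
      unfolding GG const by (simp add: mult_ac)
  qed
  have slope: "\<bar>(G t - G s) / (t - s) - pi * s ^ k\<bar> \<le> \<bar>pi * t ^ k - pi * s ^ k\<bar>"
    if "0 \<le> s" "0 \<le> t" "t \<noteq> s" for s t
  proof (cases "s < t")
    case True
    then have "pi * s ^ k \<le> (G t - G s) / (t - s)" "(G t - G s) / (t - s) \<le> pi * t ^ k"
      using annulus[of s t] that by (auto simp: field_simps)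
    then show ?thesis by linarith
  next
    case False
    then have "t < s" using that by auto
    have "(G t - G s) / (t - s) = (G s - G t) / (s - t)"
      using that by (simp add: field_simps)
    moreover have "pi * t ^ k \<le> (G s - G t) / (s - t)" "(G s - G t) / (s - t) \<le> pi * s ^ k"
      using annulus[of t s] that \<open>t < s\<close> by (auto simp: field_simps)
    ultimately show ?thesis by linarith
  qed
  have G_deriv: "(G has_field_derivative pi * s ^ k) (at s within {0..})" if "s \<ge> 0" for s
    unfolding has_field_derivative_iff
  proof (rule LIM_zero_cancel, rule Lim_null_comparison)
    show "\<forall>\<^sub>F t in at s within {0..}. norm ((G t - G s) / (t - s) - pi * s ^ k) \<le> \<bar>pi * t ^ k - pi * s ^ k\<bar>"
      unfolding eventually_at using slope[OF that] by (auto intro!: exI[of _ 1])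
    have "((\<lambda>t. \<bar>pi * t ^ k - pi * s ^ k\<bar>) \<longlongrightarrow> \<bar>pi * s ^ k - pi * s ^ k\<bar>) (at s within {0..})"
      by (intro tendsto_intros)
    then show "((\<lambda>t. \<bar>pi * t ^ k - pi * s ^ k\<bar>) \<longlongrightarrow> 0) (at s within {0..})"
      by simp
  qed
  have "(D has_field_derivative 0) (at s within {0..})" if "s \<ge> 0" for s
    unfolding D_def
    by (rule derivative_eq_intros G_deriv that refl)+
       (simp_all add: field_simps add_eq_0_iff of_nat_Suc[symmetric] del: of_nat_Suc)
  then obtain c where c: "\<And>s. s \<in> {0..} \<Longrightarrow> D s = c"
    using has_field_derivative_zero_constant[of "{0..}" D] by auto
  have "D 0 = 0" by (simp add: D_def G_def set_lebesgue_integral_def)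
  then have "D s = 0" using c[of 0] c[of s] assms by auto
  then show ?thesis by (simp add: D_def G_def)
qed

text \<open>For \<open>a \<noteq> b\<close> a suitable rotation changes the sign of the integrand and preserves the measure.\<close>

lemma moment_ball:
  assumes "r \<ge> 0"
  shows "(LINT z:ball (0::complex) r|lborel. z ^ a * cnj z ^ b) =
    (if a = b then of_real (pi * r ^ (2 * a + 2) / (a + 1)) else 0)"
proof (cases "a = b")
  case True
  have "(LINT z:ball (0::complex) r|lborel. z ^ a * cnj z ^ a) =
      (LINT z:ball (0::complex) r|lborel. of_real (cmod z ^ (2 * a)))"
    by (intro set_lebesgue_integral_cong)
       (auto simp: power_mult_distrib[symmetric] complex_norm_square[symmetric] power_mult)
  also have "\<dots> = of_real (LINT z:ball (0::complex) (sqrt (r\<^sup>2))|lborel. cmod z ^ (2 * a))"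
    using assms by (subst set_integral_complex_of_real) simp
  also have "\<dots> = of_real (pi * (r\<^sup>2) ^ Suc a / (a + 1))"
    by (subst radial_moment) auto
  also have "(r\<^sup>2) ^ Suc a = r ^ (2 * a + 2)"
    by (simp only: power_mult[symmetric]) simp
  finally show ?thesis using True by simp
next
  case False
  \<comment> \<open>The angle is chosen so that \<open>z ^ a * cnj z ^ b\<close> is multiplied by \<open>cis pi = -1\<close>.\<close>
  define t where "t = pi / (real a - real b)"
  define w where "w = cis t"
  define f where "f = (\<lambda>z::complex. indicator (ball 0 r) z *\<^sub>R (z ^ a * cnj z ^ b))"
  have f_meas: "f \<in> borel_measurable borel"
  proof -
    have "(\<lambda>z::complex. z ^ a * cnj z ^ b) \<in> borel_measurable borel"
      by (intro borel_measurable_continuous_onI continuous_intros)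
    then show ?thesis unfolding f_def by (intro borel_measurable_scaleR borel_measurable_indicator) auto
  qed
  have "(real a - real b) * t = pi"
    using False by (simp add: t_def)
  then have "real a * t - real b * t = pi"
    by (simp only: left_diff_distrib)
  then have "w ^ a * cnj w ^ b = -1"
    by (simp add: w_def Complex.DeMoivre cis_cnj cis_mult)
  moreover have "f (w * z) = (w ^ a * cnj w ^ b) * f z" for z
    by (auto simp: f_def w_def indicator_def norm_mult power_mult_distrib)
  ultimately have rot: "f (w * z) = - f z" for z by simp
  have "integral\<^sup>L lborel f = integral\<^sup>L (distr lborel borel (\<lambda>z. w * z)) f"
    by (subst lborel_distr_rotation) (auto simp: w_def)
  also have "\<dots> = integral\<^sup>L lborel (\<lambda>z. f (w * z))"
    by (rule integral_distr) (use f_meas in auto)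
  also have "\<dots> = - integral\<^sup>L lborel f" by (simp add: rot)
  finally have "integral\<^sup>L lborel f = 0" by simp
  then show ?thesis using False by (simp add: f_def set_lebesgue_integral_def)
qed

section \<open>Taylor coefficients and area integrals over discs\<close>

lemma taylor_coeff_sums:
  assumes "f holomorphic_on ball 0 R" "cmod z < R"
  shows "(\<lambda>k. taylor_coeff f k * z ^ k) sums f z"
  using holomorphic_power_series[OF assms(1), of z] assms(2) by (simp add: taylor_coeff_def)

lemma taylor_coeff_eqI:
  assumes "R > 0" "\<And>z. cmod z < R \<Longrightarrow> (\<lambda>k. a k * z ^ k) sums f z"
  shows "taylor_coeff f = a"
proof -
  have "eventually (\<lambda>z::complex. z \<in> ball 0 R) (nhds 0)"
    using assms(1) by (intro eventually_nhds_in_open) auto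
  then have "f has_fps_expansion Abs_fps a"
    by (intro has_fps_expansionI) (auto elim!: eventually_mono intro: assms(2))
  then have "fps_expansion f 0 = Abs_fps a" by (rule fps_expansion_eqI)
  then show ?thesis by (auto simp: fps_expansion_def taylor_coeff_def fun_eq_iff fps_eq_iff)
qed

lemma taylor_coeff_cong:
  assumes "R > 0" "f holomorphic_on ball 0 R" "\<And>z. cmod z < R \<Longrightarrow> f z = g z"
  shows "taylor_coeff g = taylor_coeff f"
  by (rule taylor_coeff_eqI[OF assms(1)]) (use taylor_coeff_sums[OF assms(2)] assms(3) in metis)

lemma taylor_coeff_deriv: "taylor_coeff (deriv f) k = of_nat (Suc k) * taylor_coeff f (Suc k)"
  by (simp add: taylor_coeff_def funpow_swap1 field_simps del: of_nat_Suc)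

lemma summable_norm_taylor_coeff:
  assumes "f holomorphic_on ball 0 R" "0 \<le> r" "r < R"
  shows "summable (\<lambda>k. cmod (taylor_coeff f k) * r ^ k)"
proof -
  define s where "s = (r + R) / 2"
  have "r < s" "s < R" "0 < s" using assms by (auto simp: s_def)
  then have "summable (\<lambda>k. taylor_coeff f k * of_real s ^ k)"
    using taylor_coeff_sums[OF assms(1), of "of_real s"] by (auto simp: sums_iff)
  then have "summable (\<lambda>k. norm (taylor_coeff f k * of_real r ^ k))"
    by (rule powser_insidea) (use assms \<open>r < s\<close> in auto)
  then show ?thesis using assms by (simp add: norm_mult norm_power)
qed

lemma set_integral_sum_swap:
  fixes f :: "'i \<Rightarrow> 'a \<Rightarrow> 'b::{banach, second_countable_topology}"
  assumes "\<And>i. i \<in> I \<Longrightarrow> set_integrable M A (f i)"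
  shows "(LINT x:A|M. \<Sum>i\<in>I. f i x) = (\<Sum>i\<in>I. LINT x:A|M. f i x)"
  using assms unfolding set_lebesgue_integral_def set_integrable_def scaleR_sum_right
  by (intro Bochner_Integration.integral_sum)

text \<open>Parseval's identity for area measure on a disc strictly inside the domain: there the Taylor
  polynomials are uniformly bounded, so the orthogonality of the monomials passes to the limit.\<close>

lemma integral_ball_mult_cnj:
  assumes f: "f holomorphic_on ball 0 R" and g: "g holomorphic_on ball 0 R" and r: "0 \<le> r" "r < R"
  shows "(\<lambda>k. of_real (pi * r ^ (2 * k + 2) / (k + 1)) * (taylor_coeff f k * cnj (taylor_coeff g k)))
    sums (LINT z:ball 0 r|lborel. f z * cnj (g z))"
proof -
  define F where "F N z = (\<Sum>k<N. taylor_coeff f k * z ^ k)" for N :: nat and z :: complex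
  define G where "G N z = (\<Sum>k<N. taylor_coeff g k * z ^ k)" for N :: nat and z :: complex
  define A where "A = (\<Sum>k. cmod (taylor_coeff f k) * r ^ k)"
  define B where "B = (\<Sum>k. cmod (taylor_coeff g k) * r ^ k)"
  have bound: "cmod (\<Sum>k<N. taylor_coeff h k * z ^ k) \<le> (\<Sum>k. cmod (taylor_coeff h k) * r ^ k)"
    if "h holomorphic_on ball 0 R" "cmod z \<le> r" for h z and N :: nat
  proof -
    have "cmod (\<Sum>k<N. taylor_coeff h k * z ^ k) \<le> (\<Sum>k<N. cmod (taylor_coeff h k * z ^ k))"
      by (rule norm_sum)
    also have "\<dots> \<le> (\<Sum>k<N. cmod (taylor_coeff h k) * r ^ k)"
      using that by (intro sum_mono) (auto simp: norm_mult norm_power intro!: mult_left_mono power_mono)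
    also have "\<dots> \<le> (\<Sum>k. cmod (taylor_coeff h k) * r ^ k)"
      using summable_norm_taylor_coeff[OF that(1) r] r by (intro sum_le_suminf) auto
    finally show ?thesis .
  qed
  have int: "set_integrable lborel (ball 0 r) (\<lambda>z::complex. c * (z ^ k * cnj z ^ l))" for c k l
    by (intro set_integrable_continuous_ball continuous_intros)
  have partial: "(LINT z:ball 0 r|lborel. F N z * cnj (G N z)) =
    (\<Sum>k<N. of_real (pi * r ^ (2 * k + 2) / (k + 1)) * (taylor_coeff f k * cnj (taylor_coeff g k)))" for N
  proof -
    have "F N z * cnj (G N z) = (\<Sum>k<N. \<Sum>l<N. taylor_coeff f k * cnj (taylor_coeff g l) * (z ^ k * cnj z ^ l))" for z
      by (simp add: F_def G_def sum_product mult_ac)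
    then have "(LINT z:ball 0 r|lborel. F N z * cnj (G N z)) =
      (LINT z:ball 0 r|lborel. (\<Sum>k<N. \<Sum>l<N. taylor_coeff f k * cnj (taylor_coeff g l) * (z ^ k * cnj z ^ l)))"
      by simp
    also have "\<dots> = (\<Sum>k<N. LINT z:ball 0 r|lborel. (\<Sum>l<N. taylor_coeff f k * cnj (taylor_coeff g l) * (z ^ k * cnj z ^ l)))"
      by (rule set_integral_sum_swap) (intro set_integrable_continuous_ball continuous_intros)
    also have "\<dots> = (\<Sum>k<N. \<Sum>l<N. LINT z:ball 0 r|lborel. taylor_coeff f k * cnj (taylor_coeff g l) * (z ^ k * cnj z ^ l))"
      by (intro sum.cong refl set_integral_sum_swap) (auto intro!: int)
    also have "\<dots> = (\<Sum>k<N. \<Sum>l<N. if l = k then of_real (pi * r ^ (2 * k + 2) / (k + 1)) * (taylor_coeff f k * cnj (taylor_coeff g k)) else 0)"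
      unfolding set_integral_mult_right by (intro sum.cong refl) (simp add: moment_ball[OF r(1)])
    also have "\<dots> = (\<Sum>k<N. of_real (pi * r ^ (2 * k + 2) / (k + 1)) * (taylor_coeff f k * cnj (taylor_coeff g k)))"
      by (intro sum.cong refl) simp
    finally show ?thesis .
  qed
  have lim: "(\<lambda>N. LINT z:ball 0 r|lborel. F N z * cnj (G N z)) \<longlonglongrightarrow> (LINT z:ball 0 r|lborel. f z * cnj (g z))"
    unfolding set_lebesgue_integral_def
  proof (rule integral_dominated_convergence)
    show "integrable lborel (\<lambda>z::complex. indicator (ball 0 r) z *\<^sub>R (A * B))"
      using set_integrable_continuous_ball[of r "\<lambda>_. A * B"] by (simp add: set_integrable_def)
    show "(\<lambda>z. indicator (ball 0 r) z *\<^sub>R (f z * cnj (g z))) \<in> borel_measurable lborel"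
    proof -
      have "continuous_on (ball 0 R) f" "continuous_on (ball 0 R) g"
        using f g by (auto intro: holomorphic_on_imp_continuous_on)
      then have "continuous_on (ball 0 r) f" "continuous_on (ball 0 r) g"
        using r by (auto elim!: continuous_on_subset)
      then show ?thesis
        by (simp, intro borel_measurable_continuous_on_indicator) (auto intro!: continuous_intros)
    qed
    show "(\<lambda>z. indicator (ball 0 r) z *\<^sub>R (F N z * cnj (G N z))) \<in> borel_measurable lborel" for N
      unfolding F_def G_def
      by (simp, intro borel_measurable_continuous_on_indicator) (auto intro!: continuous_intros)
    show "AE z in lborel. (\<lambda>N. indicator (ball 0 r) z *\<^sub>R (F N z * cnj (G N z))) \<longlonglongrightarrow>
        indicator (ball 0 r) z *\<^sub>R (f z * cnj (g z))"
    proof (rule AE_I2)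
      fix z :: complex
      show "(\<lambda>N. indicator (ball 0 r) z *\<^sub>R (F N z * cnj (G N z))) \<longlonglongrightarrow>
        indicator (ball 0 r) z *\<^sub>R (f z * cnj (g z))"
      proof (cases "z \<in> ball 0 r")
        case True
        then have "cmod z < R" using r by simp
        then have "(\<lambda>N. F N z) \<longlonglongrightarrow> f z" "(\<lambda>N. G N z) \<longlonglongrightarrow> g z"
          using taylor_coeff_sums[OF f] taylor_coeff_sums[OF g] by (auto simp: F_def G_def sums_def)
        then show ?thesis by (intro tendsto_intros)
      qed auto
    qed
    show "AE z in lborel. norm (indicator (ball 0 r) z *\<^sub>R (F N z * cnj (G N z))) \<le> indicator (ball 0 r) z *\<^sub>R (A * B)" for N
    proof (rule AE_I2)
      fix z :: complex
      show "norm (indicator (ball 0 r) z *\<^sub>R (F N z * cnj (G N z))) \<le> indicator (ball 0 r) z *\<^sub>R (A * B)"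
      proof (cases "z \<in> ball 0 r")
        case True
        then have "cmod (F N z) \<le> A" "cmod (G N z) \<le> B"
          unfolding F_def G_def A_def B_def by (auto intro!: bound f g)
        then show ?thesis using True
          by (auto simp: norm_mult intro!: mult_mono order_trans[OF norm_ge_zero])
      qed auto
    qed
  qed
  then show ?thesis unfolding sums_def partial .
qed

lemma integral_ball_deriv_mult_cnj:
  assumes f: "f holomorphic_on unit_disc" and g: "g holomorphic_on unit_disc" and r: "0 \<le> r" "r < 1"
  shows "(\<lambda>k. of_real (r ^ (2 * k)) * (of_nat k * (taylor_coeff f k * cnj (taylor_coeff g k))))
    sums (of_real (1 / pi) * (LINT z:ball 0 r|lborel. deriv f z * cnj (deriv g z)))"
proof -
  have "(\<lambda>k. of_real (1 / pi) * (of_real (pi * r ^ (2 * k + 2) / (k + 1)) * (taylor_coeff (deriv f) k * cnj (taylor_coeff (deriv g) k))))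
    sums (of_real (1 / pi) * (LINT z:ball 0 r|lborel. deriv f z * cnj (deriv g z)))"
    by (intro sums_mult integral_ball_mult_cnj[OF _ _ r] holomorphic_deriv f g) auto
  also have "(\<lambda>k. of_real (1 / pi) * (of_real (pi * r ^ (2 * k + 2) / (k + 1)) * (taylor_coeff (deriv f) k * cnj (taylor_coeff (deriv g) k))))
    = (\<lambda>k. of_real (r ^ (2 * Suc k)) * (of_nat (Suc k) * (taylor_coeff f (Suc k) * cnj (taylor_coeff g (Suc k)))))"
  proof
    fix k
    have "of_real (1 / pi) * (complex_of_real (pi * r ^ (2 * k + 2) / (k + 1)) * (of_nat (Suc k) * a * cnj (of_nat (Suc k) * b)))
       = of_real (r ^ (2 * Suc k)) * (of_nat (Suc k) * (a * cnj b))" for a b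
    proof -
      have "of_real (1 / pi) * (complex_of_real (pi * r ^ (2 * k + 2) / (k + 1)) * (of_nat (Suc k) * a * cnj (of_nat (Suc k) * b)))
        = of_real (1 / pi * (pi * r ^ (2 * k + 2) / (k + 1)) * (real (Suc k) * real (Suc k))) * (a * cnj b)"
        by (simp only: of_real_mult of_real_of_nat_eq complex_cnj_mult complex_cnj_of_nat mult_ac)
      also have "1 / pi * (pi * r ^ (2 * k + 2) / (k + 1)) * (real (Suc k) * real (Suc k)) = r ^ (2 * Suc k) * real (Suc k)"
        by (simp add: field_simps del: of_nat_Suc) 
      finally show ?thesis by (simp only: of_real_mult of_real_of_nat_eq mult_ac)
    qed
    then show "of_real (1 / pi) * (of_real (pi * r ^ (2 * k + 2) / (k + 1)) * (taylor_coeff (deriv f) k * cnj (taylor_coeff (deriv g) k)))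
      = of_real (r ^ (2 * Suc k)) * (of_nat (Suc k) * (taylor_coeff f (Suc k) * cnj (taylor_coeff g (Suc k))))"
      by (simp only: taylor_coeff_deriv)
  qed
  finally show ?thesis by (subst (asm) sums_Suc_iff) simp
qed

section \<open>The Dirichlet space in Taylor coefficients\<close>

lemma integral_ball_norm_deriv:
  assumes f: "f holomorphic_on unit_disc" and r: "0 \<le> r" "r < 1"
  shows "(\<lambda>k. r ^ (2 * k) * (real k * (cmod (taylor_coeff f k))\<^sup>2))
    sums (1 / pi * (LINT z:ball 0 r|lborel. (cmod (deriv f z))\<^sup>2))"
proof -
  have "(LINT z:ball 0 r|lborel. deriv f z * cnj (deriv f z))
    = (LINT z:ball 0 r|lborel. complex_of_real ((cmod (deriv f z))\<^sup>2))"
    by (simp only: complex_norm_square)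
  also have "\<dots> = complex_of_real (LINT z:ball 0 r|lborel. (cmod (deriv f z))\<^sup>2)"
    by (rule set_integral_complex_of_real)
  finally have "(\<lambda>k. complex_of_real (r ^ (2 * k) * (real k * (cmod (taylor_coeff f k))\<^sup>2)))
    sums (complex_of_real (1 / pi * (LINT z:ball 0 r|lborel. (cmod (deriv f z))\<^sup>2)))"
    using integral_ball_deriv_mult_cnj[OF f f r]
    by (simp add: complex_norm_square[symmetric])
  then show ?thesis by (simp only: sums_of_real_iff)
qed

definition inner_radius :: "nat \<Rightarrow> real" where
  "inner_radius m = 1 - 1 / real (Suc m)"

lemma inner_radius_nonneg: "0 \<le> inner_radius m"
  and inner_radius_less_1: "inner_radius m < 1"
  by (auto simp: inner_radius_def field_simps)

lemma mono_inner_radius: "mono inner_radius"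
  by (rule monoI) (auto simp: inner_radius_def field_simps)

lemma tendsto_inner_radius: "inner_radius \<longlonglongrightarrow> 1"
proof -
  have "(\<lambda>m. 1 - 1 / real (Suc m)) \<longlonglongrightarrow> 1 - 0"
    by (intro tendsto_diff tendsto_const LIMSEQ_Suc[OF lim_1_over_n])
  then show ?thesis by (simp add: inner_radius_def[abs_def])
qed

text \<open>This pointwise limit lets the convergence theorems carry identities from smaller discs to the
  unit disc.\<close>

lemma tendsto_indicator_inner_radius:
  fixes h :: "complex \<Rightarrow> 'a::real_normed_vector"
  shows "(\<lambda>m. indicator (ball 0 (inner_radius m)) z *\<^sub>R h z) \<longlonglongrightarrow> indicator unit_disc z *\<^sub>R h z"
proof (cases "z \<in> unit_disc")
  case True
  then have "eventually (\<lambda>m. cmod z < inner_radius m) sequentially"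
    by (intro order_tendstoD[OF tendsto_inner_radius]) auto
  then have "eventually (\<lambda>m. indicator (ball 0 (inner_radius m)) z *\<^sub>R h z = indicator unit_disc z *\<^sub>R h z) sequentially"
    by eventually_elim (use True in auto)
  then show ?thesis by (rule tendsto_eventually)
next
  case False
  then have "z \<notin> ball 0 (inner_radius m)" for m
    using inner_radius_less_1[of m] by auto
  then show ?thesis using False by simp
qed

lemma borel_measurable_indicator_deriv:
  assumes "f holomorphic_on unit_disc" "A \<in> sets borel" "A \<subseteq> unit_disc"
  shows "(\<lambda>z. indicator A z *\<^sub>R deriv f z) \<in> borel_measurable borel"
proof -
  have "continuous_on unit_disc (deriv f)"
    using assms by (intro holomorphic_on_imp_continuous_on holomorphic_deriv) auto
  then show ?thesis
    using assms by (intro borel_measurable_continuous_on_indicator) (auto elim: continuous_on_subset)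
qed

text \<open>On the disc of radius \<open>r < 1\<close> the integral of \<open>\<bar>f'\<bar>\<^sup>2\<close> is \<open>pi\<close> times a power series in \<open>r\<^sup>2\<close> with
  nonnegative coefficients, so as \<open>r\<close> tends to 1 the integral and the sum stay bounded together.\<close>

lemma dirichlet_space_iff_summable:
  "f \<in> dirichlet_space \<longleftrightarrow> f holomorphic_on unit_disc \<and> (\<forall>z. z \<notin> unit_disc \<longrightarrow> f z = 0) \<and>
     summable (\<lambda>k. real k * (cmod (taylor_coeff f k))\<^sup>2)"
proof -
  have "set_integrable lborel unit_disc (\<lambda>z. (cmod (deriv f z))\<^sup>2) \<longleftrightarrow>
     summable (\<lambda>k. real k * (cmod (taylor_coeff f k))\<^sup>2)" if f: "f holomorphic_on unit_disc"
  proof -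
    let ?c = "\<lambda>k. real k * (cmod (taylor_coeff f k))\<^sup>2"
    let ?I = "\<lambda>m. LINT z:ball 0 (inner_radius m)|lborel. (cmod (deriv f z))\<^sup>2"
    have sub: "ball 0 (inner_radius m) \<subseteq> unit_disc" for m
      using inner_radius_less_1[of m] by (intro subset_ball) simp
    have sums: "(\<lambda>k. inner_radius m ^ (2 * k) * ?c k) sums (1 / pi * ?I m)" for m
      by (rule integral_ball_norm_deriv[OF f inner_radius_nonneg inner_radius_less_1])
    have le: "inner_radius m ^ (2 * k) * ?c k \<le> ?c k" for m k
      using inner_radius_nonneg[of m] inner_radius_less_1[of m]
      by (intro mult_left_le_one_le) (auto intro: power_le_one)
    have "summable ?c" if int: "set_integrable lborel unit_disc (\<lambda>z. (cmod (deriv f z))\<^sup>2)"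
    proof (rule summableI_nonneg_bounded)
      fix N
      let ?B = "1 / pi * (LINT z:unit_disc|lborel. (cmod (deriv f z))\<^sup>2)"
      have "(\<Sum>k<N. inner_radius m ^ (2 * k) * ?c k) \<le> ?B" for m
      proof -
        have "(\<Sum>k<N. inner_radius m ^ (2 * k) * ?c k) \<le> (\<Sum>k. inner_radius m ^ (2 * k) * ?c k)"
          using sums[of m] inner_radius_nonneg[of m]
          by (intro sum_le_suminf) (auto simp: sums_iff)
        also have "\<dots> = 1 / pi * ?I m" using sums[of m] by (simp add: sums_iff)
        also have "?I m \<le> (LINT z:unit_disc|lborel. (cmod (deriv f z))\<^sup>2)"
          unfolding set_lebesgue_integral_def
          using int set_integrable_subset[OF int _ sub[of m]] sub[of m]
          by (intro integral_mono) (auto simp: set_integrable_def indicator_def)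
        finally show ?thesis by (simp add: divide_right_mono)
      qed
      moreover have "(\<lambda>m. \<Sum>k<N. inner_radius m ^ (2 * k) * ?c k) \<longlonglongrightarrow> (\<Sum>k<N. 1 ^ (2 * k) * ?c k)"
        by (intro tendsto_intros tendsto_inner_radius)
      ultimately show "(\<Sum>k<N. ?c k) \<le> ?B"
        by (intro LIMSEQ_le_const2[where X = "\<lambda>m. \<Sum>k<N. inner_radius m ^ (2 * k) * ?c k"]) auto
    qed auto
    moreover have "set_integrable lborel unit_disc (\<lambda>z. (cmod (deriv f z))\<^sup>2)" if c: "summable ?c"
    proof -
      let ?h = "\<lambda>m z. indicator (ball 0 (inner_radius m)) z *\<^sub>R (cmod (deriv f z))\<^sup>2"
      have meas: "(\<lambda>z. indicator A z *\<^sub>R (cmod (deriv f z))\<^sup>2) \<in> borel_measurable borel"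
        if "A \<in> sets borel" "A \<subseteq> unit_disc" for A
      proof -
        have "(\<lambda>z. (cmod (indicator A z *\<^sub>R deriv f z))\<^sup>2) \<in> borel_measurable borel"
          using borel_measurable_indicator_deriv[OF f that] by measurable
        also have "(\<lambda>z. (cmod (indicator A z *\<^sub>R deriv f z))\<^sup>2) = (\<lambda>z. indicator A z *\<^sub>R (cmod (deriv f z))\<^sup>2)"
          by (auto simp: indicator_def)
        finally show ?thesis .
      qed
      have int: "integrable lborel (?h m)" for m
      proof -
        have "continuous_on (cball 0 (inner_radius m)) (deriv f)"
          using inner_radius_less_1[of m] f
          by (intro holomorphic_on_imp_continuous_on holomorphic_on_subset[OF holomorphic_deriv]) auto
        then have "continuous_on (cball 0 (inner_radius m)) (\<lambda>z. (cmod (deriv f z))\<^sup>2)"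
          by (intro continuous_intros)
        then show ?thesis
          using set_integrable_continuous_ball unfolding set_integrable_def by blast
      qed
      have mono: "mono (\<lambda>m. ?h m z)" for z
        using mono_inner_radius by (auto simp: mono_def indicator_def intro: order_less_le_trans)
      have "incseq ?I"
        unfolding incseq_def set_lebesgue_integral_def
        using mono int by (auto intro!: integral_mono simp: mono_def)
      moreover have "?I m \<le> pi * suminf ?c" for m
      proof -
        have "1 / pi * ?I m \<le> suminf ?c"
          using sums[of m] le c by (intro sums_le[OF _ sums summable_sums]) auto
        then show ?thesis by (simp add: field_simps)
      qed
      ultimately obtain L where L: "?I \<longlonglongrightarrow> L"
        using incseq_convergent by blast
      show ?thesis unfolding set_integrable_def
      proof (rule integrable_monotone_convergence)
        show "AE z in lborel. mono (\<lambda>m. ?h m z)" using mono by simp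
        show "AE z in lborel. (\<lambda>m. ?h m z) \<longlonglongrightarrow> indicator unit_disc z *\<^sub>R (cmod (deriv f z))\<^sup>2"
          by (intro AE_I2 tendsto_indicator_inner_radius)
        show "(\<lambda>m. integral\<^sup>L lborel (?h m)) \<longlonglongrightarrow> L"
          using L by (simp add: set_lebesgue_integral_def)
        show "(\<lambda>z. indicator unit_disc z *\<^sub>R (cmod (deriv f z))\<^sup>2) \<in> borel_measurable lborel"
          using meas[of unit_disc] by simp
      qed (rule int)
    qed
    ultimately show ?thesis by blast
  qed
  then show ?thesis by (auto simp: dirichlet_space_def)
qed

lemma norm_mult_cnj_le: "cmod (a * cnj b) \<le> (cmod a)\<^sup>2 + (cmod b)\<^sup>2"
proof -
  have "0 \<le> (cmod a - cmod b)\<^sup>2" by simp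
  then have "2 * (cmod a * cmod b) \<le> (cmod a)\<^sup>2 + (cmod b)\<^sup>2"
    by (simp add: power2_diff)
  moreover have "0 \<le> cmod a * cmod b" by simp
  ultimately show ?thesis unfolding norm_mult complex_mod_cnj by linarith
qed

text \<open>The Hardy part contributes the coefficients with weight 1 and the area integral those with weight
  \<open>k\<close>. The latter is the limit of the identity on smaller discs: the integrals converge by
  dominated convergence and the series by Tannery's theorem.\<close>

lemma dirichlet_inner_sums:
  assumes f: "f \<in> dirichlet_space" and g: "g \<in> dirichlet_space"
  shows "(\<lambda>k. of_nat (Suc k) * (taylor_coeff f k * cnj (taylor_coeff g k))) sums dirichlet_inner f g"
proof -
  let ?c = "\<lambda>k. taylor_coeff f k * cnj (taylor_coeff g k)"
  let ?M = "\<lambda>k. real k * (cmod (taylor_coeff f k))\<^sup>2 + real k * (cmod (taylor_coeff g k))\<^sup>2"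
  let ?F = "\<lambda>z. deriv f z * cnj (deriv g z)"
  have hol: "f holomorphic_on unit_disc" "g holomorphic_on unit_disc"
    and M: "summable ?M"
    using f g by (auto simp: dirichlet_space_iff_summable intro: summable_add)
  have bound: "cmod (of_nat k * ?c k) \<le> ?M k" for k
    using mult_left_mono[OF norm_mult_cnj_le, of "real k"] by (simp add: norm_mult distrib_left)
  have summable_c: "summable ?c"
  proof (rule summable_comparison_test'[OF M])
    fix k :: nat assume "1 \<le> k"
    then have "1 * cmod (?c k) \<le> real k * cmod (?c k)" by (intro mult_right_mono) auto
    also have "\<dots> = cmod (of_nat k * ?c k)" by (simp add: norm_mult)
    finally show "norm (?c k) \<le> ?M k" using bound[of k] by simp
  qed
  have summable_kc: "summable (\<lambda>k. of_nat k * ?c k)"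
    by (rule summable_comparison_test'[OF M]) (use bound in auto)
  have "(\<lambda>m. \<Sum>k. of_real (inner_radius m ^ (2 * k)) * (of_nat k * ?c k)) \<longlonglongrightarrow> (\<Sum>k. of_nat k * ?c k)"
  proof (rule tannerys_theorem[THEN conjunct2, THEN conjunct2, OF _ _ M])
    show "(\<lambda>m. of_real (inner_radius m ^ (2 * k)) * (of_nat k * ?c k)) \<longlonglongrightarrow> of_nat k * ?c k" for k
    proof -
      have "(\<lambda>m. complex_of_real (inner_radius m ^ (2 * k)) * (of_nat k * ?c k)) \<longlonglongrightarrow> complex_of_real (1 ^ (2 * k)) * (of_nat k * ?c k)"
        by (intro tendsto_intros tendsto_inner_radius)
      then show ?thesis by simp
    qed
    have "norm (complex_of_real (inner_radius m ^ (2 * k)) * (of_nat k * ?c k)) \<le> ?M k" for k m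
    proof -
      have "norm (complex_of_real (inner_radius m ^ (2 * k)) * (of_nat k * ?c k)) =
        inner_radius m ^ (2 * k) * cmod (of_nat k * ?c k)"
        using inner_radius_nonneg[of m] by (simp add: norm_mult norm_power)
      also have "\<dots> \<le> cmod (of_nat k * ?c k)"
        using inner_radius_nonneg[of m] inner_radius_less_1[of m]
        by (intro mult_left_le_one_le) (auto intro: power_le_one)
      finally show ?thesis using bound[of k] by simp
    qed
    then show "\<forall>\<^sub>F (k, m) in at_top \<times>\<^sub>F sequentially.
        norm (complex_of_real (inner_radius m ^ (2 * k)) * (of_nat k * ?c k)) \<le> ?M k"
      by (intro always_eventually) auto
  qed simp
  moreover have "(\<Sum>k. of_real (inner_radius m ^ (2 * k)) * (of_nat k * ?c k)) =
      of_real (1 / pi) * (LINT z:ball 0 (inner_radius m)|lborel. ?F z)" for m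
    using integral_ball_deriv_mult_cnj[OF hol inner_radius_nonneg inner_radius_less_1]
    by (simp only: sums_iff)
  moreover have "(\<lambda>m. LINT z:ball 0 (inner_radius m)|lborel. ?F z) \<longlonglongrightarrow> (LINT z:unit_disc|lborel. ?F z)"
    unfolding set_lebesgue_integral_def
  proof (rule integral_dominated_convergence)
    have cnj: "cnj \<in> borel_measurable borel"
      by (intro borel_measurable_continuous_onI continuous_intros)
    have meas: "(\<lambda>z. indicator A z *\<^sub>R ?F z) \<in> borel_measurable lborel"
      if "A \<in> sets borel" "A \<subseteq> unit_disc" for A
    proof -
      have "(\<lambda>z. (indicator A z *\<^sub>R deriv f z) * cnj (indicator A z *\<^sub>R deriv g z)) \<in> borel_measurable borel"
        using measurable_compose[OF borel_measurable_indicator_deriv[OF hol(2) that] cnj]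
        by (intro borel_measurable_times borel_measurable_indicator_deriv[OF hol(1) that])
      also have "(\<lambda>z. (indicator A z *\<^sub>R deriv f z) * cnj (indicator A z *\<^sub>R deriv g z)) = (\<lambda>z. indicator A z *\<^sub>R ?F z)"
        by (auto simp: indicator_def)
      finally show ?thesis by simp
    qed
    show "(\<lambda>z. indicator unit_disc z *\<^sub>R ?F z) \<in> borel_measurable lborel"
      by (rule meas) auto
    show "(\<lambda>z. indicator (ball 0 (inner_radius m)) z *\<^sub>R ?F z) \<in> borel_measurable lborel" for m
      by (rule meas) (use inner_radius_less_1[of m] in \<open>auto intro: subset_ball\<close>)
    have "set_integrable lborel unit_disc (\<lambda>z. (cmod (deriv f z))\<^sup>2 + (cmod (deriv g z))\<^sup>2)"
      using f g by (intro set_integral_add) (auto simp: dirichlet_space_def)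
    then show "integrable lborel (\<lambda>z. indicator unit_disc z *\<^sub>R ((cmod (deriv f z))\<^sup>2 + (cmod (deriv g z))\<^sup>2))"
      by (simp add: set_integrable_def)
    show "AE z in lborel. (\<lambda>m. indicator (ball 0 (inner_radius m)) z *\<^sub>R ?F z) \<longlonglongrightarrow> indicator unit_disc z *\<^sub>R ?F z"
      by (intro AE_I2 tendsto_indicator_inner_radius)
    show "AE z in lborel. norm (indicator (ball 0 (inner_radius m)) z *\<^sub>R ?F z) \<le>
        indicator unit_disc z *\<^sub>R ((cmod (deriv f z))\<^sup>2 + (cmod (deriv g z))\<^sup>2)" for m
      using inner_radius_less_1[of m] norm_mult_cnj_le
      by (intro AE_I2) (auto simp: indicator_def)
  qed
  then have "(\<lambda>m. of_real (1 / pi) * (LINT z:ball 0 (inner_radius m)|lborel. ?F z)) \<longlonglongrightarrow>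
      of_real (1 / pi) * (LINT z:unit_disc|lborel. ?F z)"
    by (intro tendsto_mult tendsto_const)
  ultimately have "(\<Sum>k. of_nat k * ?c k) = of_real (1 / pi) * (LINT z:unit_disc|lborel. ?F z)"
    using LIMSEQ_unique by simp
  then have "(\<lambda>k. ?c k + of_nat k * ?c k) sums dirichlet_inner f g"
    using sums_add[OF summable_sums[OF summable_c] summable_sums[OF summable_kc]]
    by (simp add: dirichlet_inner_def hardy_inner_def)
  then show ?thesis by (simp add: distrib_right)
qed

lemma taylor_coeff_power_mult:
  assumes "f holomorphic_on unit_disc"
  shows "taylor_coeff (\<lambda>z. z ^ n * f z) k = (if k < n then 0 else taylor_coeff f (k - n))"
proof -
  have "taylor_coeff (\<lambda>z. z ^ n * f z) = (\<lambda>k. if k < n then 0 else taylor_coeff f (k - n))"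
  proof (rule taylor_coeff_eqI[of 1])
    fix z :: complex assume "cmod z < 1"
    then have "(\<lambda>k. z ^ n * (taylor_coeff f k * z ^ k)) sums (z ^ n * f z)"
      by (intro sums_mult taylor_coeff_sums[OF assms])
    then have "(\<lambda>k. (if k + n < n then 0 else taylor_coeff f (k + n - n)) * z ^ (k + n)) sums (z ^ n * f z)"
      by (simp add: power_add mult_ac)
    then show "(\<lambda>k. (if k < n then 0 else taylor_coeff f (k - n)) * z ^ k) sums (z ^ n * f z)"
      by (subst (asm) sums_iff_shift) simp
  qed simp
  then show ?thesis by simp
qed

text \<open>Parseval's identity on the unit circle. There \<open>cnj z = 1 / z\<close>, so the Taylor series of \<open>g\<close> turns
  the integrand into a uniformly convergent series of terms \<open>f z / z ^ (k + 1)\<close>, each of which is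
  evaluated by Cauchy's formula.\<close>

lemma circle_mult_cnj_sums:
  assumes f: "f holomorphic_on ball 0 R" and g: "g holomorphic_on ball 0 R" and R: "R > 1"
  shows "(\<lambda>k. taylor_coeff f k * cnj (taylor_coeff g k)) sums
    (contour_integral (circlepath 0 1) (\<lambda>z. f z * cnj (g z) / z) / (2 * of_real pi * \<i>))"
proof -
  have cont: "continuous_on (cball 0 1) f"
    using f R by (intro holomorphic_on_imp_continuous_on) (auto elim: holomorphic_on_subset)
  have hol: "f holomorphic_on ball 0 1"
    using f R by (auto elim: holomorphic_on_subset)
  have "compact (f ` sphere 0 1)"
    using cont by (intro compact_continuous_image continuous_on_subset[OF cont]) auto
  then obtain C where C: "\<And>z. z \<in> sphere 0 1 \<Longrightarrow> cmod (f z) \<le> C"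
    by (meson bounded_iff compact_imp_bounded imageI)
  define t where "t k z = cnj (taylor_coeff g k) * (f z / z ^ Suc k)" for k z
  have t_int: "(t k has_contour_integral cnj (taylor_coeff g k) * (2 * of_real pi * \<i> * taylor_coeff f k)) (circlepath 0 1)" for k
  proof -
    have "((\<lambda>z. f z / z ^ Suc k) has_contour_integral 2 * of_real pi * \<i> * taylor_coeff f k) (circlepath 0 1)"
      using Cauchy_has_contour_integral_higher_derivative_circlepath[OF cont hol, of 0 k]
      by (simp add: taylor_coeff_def)
    then show ?thesis
      unfolding t_def by (rule has_contour_integral_lmul)
  qed
  have t_sums: "(\<lambda>k. t k z) sums (f z * cnj (g z) / z)" if "z \<in> sphere 0 1" for z
  proof -
    have z: "cmod z = 1" using that by simp
    then have "z * cnj z = 1" by (simp add: complex_norm_square[symmetric])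
    then have zc: "cnj z = inverse z" by (simp add: inverse_unique)
    have "(\<lambda>k. taylor_coeff g k * z ^ k) sums g z"
      by (rule taylor_coeff_sums[OF g]) (use z R in auto)
    then have "(\<lambda>k. cnj (taylor_coeff g k * z ^ k)) sums cnj (g z)"
      by (simp only: sums_cnj)
    then have "(\<lambda>k. f z / z * cnj (taylor_coeff g k * z ^ k)) sums (f z / z * cnj (g z))"
      by (rule sums_mult)
    then show ?thesis
      by (simp add: t_def zc power_inverse field_simps)
  qed
  have t_bound: "norm (t k z) \<le> C * cmod (taylor_coeff g k)" if "z \<in> sphere 0 1" for k z
  proof -
    have "norm (t k z) = cmod (taylor_coeff g k) * cmod (f z)"
      using that by (simp add: t_def norm_mult norm_divide norm_power)
    also have "\<dots> \<le> cmod (taylor_coeff g k) * C"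
      using C[OF that] by (intro mult_left_mono) auto
    finally show ?thesis by (simp add: mult.commute)
  qed
  have "uniform_limit (sphere 0 1) (\<lambda>n z. \<Sum>k<n. t k z) (\<lambda>z. \<Sum>k. t k z) sequentially"
    using summable_norm_taylor_coeff[OF g, of 1] R
    by (intro Weierstrass_m_test[OF t_bound] summable_mult) auto
  also have "?this \<longleftrightarrow> uniform_limit (sphere 0 1) (\<lambda>n z. \<Sum>k<n. t k z) (\<lambda>z. f z * cnj (g z) / z) sequentially"
    by (rule uniform_limit_cong') (use t_sums in \<open>auto simp: sums_iff\<close>)
  finally have ul: "uniform_limit (sphere 0 1) (\<lambda>n z. \<Sum>k<n. t k z) (\<lambda>z. f z * cnj (g z) / z) sequentially" .
  have partial: "((\<lambda>z. \<Sum>k<n. t k z) has_contour_integral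
      (\<Sum>k<n. cnj (taylor_coeff g k) * (2 * of_real pi * \<i> * taylor_coeff f k))) (circlepath 0 1)" for n
    by (intro has_contour_integral_sum t_int) auto
  have "(\<lambda>n. contour_integral (circlepath 0 1) (\<lambda>z. \<Sum>k<n. t k z)) \<longlonglongrightarrow>
      contour_integral (circlepath 0 1) (\<lambda>z. f z * cnj (g z) / z)"
    by (rule contour_integral_uniform_limit_circlepath[OF _ ul])
       (use partial in \<open>auto intro!: always_eventually has_contour_integral_integrable\<close>)
  then have "(\<lambda>k. cnj (taylor_coeff g k) * (2 * of_real pi * \<i> * taylor_coeff f k)) sums
      contour_integral (circlepath 0 1) (\<lambda>z. f z * cnj (g z) / z)"
    by (simp add: sums_def contour_integral_unique[OF partial])
  then have "(\<lambda>k. cnj (taylor_coeff g k) * (2 * of_real pi * \<i> * taylor_coeff f k) / (2 * of_real pi * \<i>)) sums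
      (contour_integral (circlepath 0 1) (\<lambda>z. f z * cnj (g z) / z) / (2 * of_real pi * \<i>))"
    by (rule sums_divide)
  then show ?thesis by (simp add: mult_ac)
qed

section \<open>Finite Blaschke products on the unit circle\<close>

definition blaschke_product :: "complex \<Rightarrow> complex list \<Rightarrow> complex \<Rightarrow> complex" where
  "blaschke_product c ls z = c * (\<Prod>l\<leftarrow>ls. blaschke_factor l z)"

text \<open>The poles \<open>1 / cnj l\<close>, for nonzero \<open>l\<close>, are finitely many points outside the closed disc.\<close>

lemma obtain_pole_free_radius:
  assumes "set ls \<subseteq> unit_disc"
  obtains R where "R > 1" "\<And>l z. l \<in> set ls \<Longrightarrow> cmod z < R \<Longrightarrow> 1 - cnj l * z \<noteq> 0"
proof -
  define m where "m = Max (insert 0 (cmod ` set ls))"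
  have m: "0 \<le> m" "m < 1" "\<And>l. l \<in> set ls \<Longrightarrow> cmod l \<le> m"
    using assms by (auto simp: m_def)
  show thesis
  proof
    show "2 / (1 + m) > 1" using m by simp
    fix l z assume l: "l \<in> set ls" and z: "cmod z < 2 / (1 + m)"
    have "cmod (cnj l * z) \<le> m * (2 / (1 + m))"
      unfolding norm_mult using m z l by (intro mult_mono) auto
    also have "\<dots> < 1" using m by (simp add: field_simps)
    finally show "1 - cnj l * z \<noteq> 0" by auto
  qed
qed

lemma blaschke_product_holomorphic:
  assumes "\<And>l z. l \<in> set ls \<Longrightarrow> z \<in> A \<Longrightarrow> 1 - cnj l * z \<noteq> 0"
  shows "blaschke_product c ls holomorphic_on A"
proof -
  have "(\<lambda>z. \<Prod>l\<leftarrow>ls. blaschke_factor l z) holomorphic_on A"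
    using assms
  proof (induction ls)
    case (Cons l ls)
    then show ?case
      by (auto simp: blaschke_factor_def intro!: holomorphic_intros)
  qed auto
  then show ?thesis
    unfolding blaschke_product_def[abs_def] by (intro holomorphic_intros)
qed

lemma norm_blaschke_factor_circle:
  assumes "cmod z = 1" "cmod l < 1"
  shows "cmod (blaschke_factor l z) = 1"
proof -
  have "z * cnj z = 1" using assms by (simp add: complex_norm_square[symmetric])
  then have "1 - cnj l * z = z * cnj (z - l)"
    by (simp add: algebra_simps)
  then have "cmod (1 - cnj l * z) = cmod (l - z)"
    using assms by (simp only: norm_mult complex_mod_cnj) (simp add: norm_minus_commute)
  moreover have "l \<noteq> z" using assms by auto
  ultimately show ?thesis by (simp add: blaschke_factor_def norm_divide)
qed

lemma norm_blaschke_product_circle: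
  assumes "cmod z = 1" "set ls \<subseteq> unit_disc" "cmod c = 1"
  shows "cmod (blaschke_product c ls z) = 1"
proof -
  have "cmod (\<Prod>l\<leftarrow>ls. blaschke_factor l z) = 1"
    using assms(2) by (induction ls) (auto simp: norm_mult norm_blaschke_factor_circle assms(1))
  then show ?thesis by (simp add: blaschke_product_def norm_mult assms)
qed

text \<open>This is the logarithmic derivative of a Blaschke factor, in partial fractions.\<close>

definition blaschke_log_deriv :: "complex \<Rightarrow> complex \<Rightarrow> complex" where
  "blaschke_log_deriv l z = 1 / (z - l) + cnj l / (1 - cnj l * z)"

lemma blaschke_factor_has_derivative:
  assumes "z \<noteq> l" "1 - cnj l * z \<noteq> 0"
  shows "(blaschke_factor l has_field_derivative blaschke_factor l z * blaschke_log_deriv l z) (at z)"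
proof -
  have "(blaschke_factor l has_field_derivative
      ((- 1) * (1 - cnj l * z) - (l - z) * (- cnj l)) / ((1 - cnj l * z) * (1 - cnj l * z))) (at z)"
    unfolding blaschke_factor_def[abs_def]
    by (rule derivative_eq_intros refl assms)+ simp
  also have "((- 1) * (1 - cnj l * z) - (l - z) * (- cnj l)) / ((1 - cnj l * z) * (1 - cnj l * z))
      = blaschke_factor l z * blaschke_log_deriv l z"
  proof -
    have "z - l \<noteq> 0" using assms by simp
    with assms(2) show ?thesis
      unfolding blaschke_factor_def blaschke_log_deriv_def
      by (simp add: divide_simps) algebra
  qed
  finally show ?thesis .
qed

lemma deriv_blaschke_product:
  assumes "cmod z = 1" "set ls \<subseteq> unit_disc"
  shows "deriv (blaschke_product c ls) z = blaschke_product c ls z * (\<Sum>l\<leftarrow>ls. blaschke_log_deriv l z)"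
proof -
  have "((\<lambda>z. \<Prod>l\<leftarrow>ls. blaschke_factor l z) has_field_derivative
      (\<Prod>l\<leftarrow>ls. blaschke_factor l z) * (\<Sum>l\<leftarrow>ls. blaschke_log_deriv l z)) (at z)"
    using assms(2)
  proof (induction ls)
    case (Cons l ls)
    have "cmod l < 1" using Cons.prems by simp
    then have "z \<noteq> l" "cmod (cnj l * z) \<noteq> 1" using assms(1) by (auto simp: norm_mult)
    then have "z \<noteq> l" "1 - cnj l * z \<noteq> 0" by auto
    note D = DERIV_mult[OF blaschke_factor_has_derivative[OF this] Cons.IH]
    show ?case using D Cons.prems by (simp add: algebra_simps)
  qed simp
  then have "(blaschke_product c ls has_field_derivative
      c * ((\<Prod>l\<leftarrow>ls. blaschke_factor l z) * (\<Sum>l\<leftarrow>ls. blaschke_log_deriv l z))) (at z)"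
    unfolding blaschke_product_def[abs_def] by (rule DERIV_cmult)
  then show ?thesis by (simp add: DERIV_imp_deriv blaschke_product_def mult.assoc)
qed

text \<open>Only the first summand of the logarithmic derivative has a pole inside the circle.\<close>

lemma power_mult_log_deriv_contour_integral:
  assumes "cmod l < 1"
  shows "((\<lambda>z. z ^ j * blaschke_log_deriv l z) has_contour_integral 2 * of_real pi * \<i> * l ^ j) (circlepath 0 1)"
proof -
  have 1: "((\<lambda>z. z ^ j / (z - l)) has_contour_integral 2 * of_real pi * \<i> * l ^ j) (circlepath 0 1)"
    by (rule Cauchy_integral_circlepath) (use assms in \<open>auto intro!: continuous_intros holomorphic_intros\<close>)
  obtain R where R: "R > 1" "\<And>z. cmod z < R \<Longrightarrow> 1 - cnj l * z \<noteq> 0"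
    using obtain_pole_free_radius[of "[l]"] assms
    by (metis empty_set list.simps(15) mem_ball_0 singletonI singletonD subsetI)
  have 2: "((\<lambda>z. z ^ j * cnj l / (1 - cnj l * z)) has_contour_integral 0) (circlepath 0 1)"
    by (rule Cauchy_theorem_convex_simple[of _ "ball 0 R"])
       (use R in \<open>auto intro!: holomorphic_intros\<close>)
  show ?thesis
    using has_contour_integral_add[OF 1 2] by (simp add: blaschke_log_deriv_def distrib_left)
qed

text \<open>The weighted sum is \<open>\<langle>z ^ j * B, B\<rangle>\<close> in the Dirichlet space. The weight \<open>k + 1\<close> is produced by
  differentiating \<open>z ^ (j + 1) * B\<close>, and on the circle \<open>cnj B = 1 / B\<close>. So, up to the factor \<open>2 * pi * \<i>\<close>,
  the sum is a contour integral of \<open>(j + 1) * z ^ (j - 1) + z ^ j * B' / B\<close>, whose second part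
  picks up \<open>l ^ j\<close> at each zero \<open>l\<close>.\<close>

lemma blaschke_product_inner_sums:
  assumes c: "cmod c = 1" and ls: "set ls \<subseteq> unit_disc"
  shows "(\<lambda>k. of_nat (Suc k) * (taylor_coeff (\<lambda>z. z ^ j * blaschke_product c ls z) k *
            cnj (taylor_coeff (blaschke_product c ls) k)))
         sums (of_nat (Suc j) * 0 ^ j + (\<Sum>l\<leftarrow>ls. l ^ j))"
proof -
  let ?B = "blaschke_product c ls"
  let ?H = "\<lambda>z. z ^ Suc j * ?B z"
  obtain R where R: "R > 1" "\<And>l z. l \<in> set ls \<Longrightarrow> cmod z < R \<Longrightarrow> 1 - cnj l * z \<noteq> 0"
    using obtain_pole_free_radius[OF ls] by metis
  have B: "?B holomorphic_on ball 0 R"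
    by (rule blaschke_product_holomorphic) (use R in auto)
  have B1: "?B holomorphic_on unit_disc"
    using B R(1) by (auto elim: holomorphic_on_subset)
  have H: "?H holomorphic_on ball 0 R"
    using B by (intro holomorphic_intros)
  have coeff: "taylor_coeff (deriv ?H) k = of_nat (Suc k) * taylor_coeff (\<lambda>z. z ^ j * ?B z) k" for k
    unfolding taylor_coeff_deriv by (simp only: taylor_coeff_power_mult[OF B1] Suc_less_eq diff_Suc_Suc)
  have on_circle: "deriv ?H z * cnj (?B z) / z
      = of_nat (Suc j) * (z ^ j / (z - 0)) + (\<Sum>l\<leftarrow>ls. z ^ j * blaschke_log_deriv l z)"
    if "z \<in> path_image (circlepath 0 1)" for z
  proof -
    have z: "cmod z = 1" using that by simp
    have z0: "z \<noteq> 0" using z by auto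
    \<comment> \<open>Boundary values of a Blaschke product are unimodular, so \<open>cnj B\<close> acts as division by \<open>B\<close>.\<close>
    have BB: "?B z * cnj (?B z) = 1"
      using norm_blaschke_product_circle[OF z ls c] by (simp add: complex_norm_square[symmetric])
    have "?B field_differentiable at z"
      using holomorphic_on_imp_differentiable_at[OF B] z R(1) by auto
    then have "(?H has_field_derivative (of_nat (Suc j) * z ^ j * ?B z + deriv ?B z * z ^ Suc j)) (at z)"
      by (intro DERIV_mult field_differentiable_derivI DERIV_power[THEN DERIV_cong, OF DERIV_ident]) simp_all
    then have "deriv ?H z = of_nat (Suc j) * z ^ j * ?B z + deriv ?B z * z ^ Suc j"
      by (rule DERIV_imp_deriv)
    also have "\<dots> = ?B z * (of_nat (Suc j) * z ^ j + z ^ Suc j * (\<Sum>l\<leftarrow>ls. blaschke_log_deriv l z))"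
      unfolding deriv_blaschke_product[OF z ls] by (simp only: distrib_left mult_ac)
    finally have "deriv ?H z * cnj (?B z) =
        (?B z * cnj (?B z)) * (of_nat (Suc j) * z ^ j + z ^ Suc j * (\<Sum>l\<leftarrow>ls. blaschke_log_deriv l z))"
      by (simp only: mult_ac)
    then show ?thesis
      unfolding BB using z0 by (simp add: sum_list_const_mult add_divide_distrib)
  qed
  have sum_int: "((\<lambda>z. \<Sum>l\<leftarrow>ls. z ^ j * blaschke_log_deriv l z) has_contour_integral
      (\<Sum>l\<leftarrow>ls. 2 * of_real pi * \<i> * l ^ j)) (circlepath 0 1)"
    using ls by (induction ls) (auto simp: has_contour_integral_0 intro!: has_contour_integral_add power_mult_log_deriv_contour_integral)
  have "((\<lambda>z. z ^ j / (z - 0)) has_contour_integral 2 * of_real pi * \<i> * 0 ^ j) (circlepath 0 1)"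
    by (rule Cauchy_integral_circlepath) (auto intro!: continuous_intros holomorphic_intros)
  then have "((\<lambda>z. of_nat (Suc j) * (z ^ j / (z - 0)) + (\<Sum>l\<leftarrow>ls. z ^ j * blaschke_log_deriv l z)) has_contour_integral
      of_nat (Suc j) * (2 * of_real pi * \<i> * 0 ^ j) + (\<Sum>l\<leftarrow>ls. 2 * of_real pi * \<i> * l ^ j)) (circlepath 0 1)"
    by (intro has_contour_integral_add has_contour_integral_lmul sum_int)
  then have "((\<lambda>z. deriv ?H z * cnj (?B z) / z) has_contour_integral
      of_nat (Suc j) * (2 * of_real pi * \<i> * 0 ^ j) + (\<Sum>l\<leftarrow>ls. 2 * of_real pi * \<i> * l ^ j)) (circlepath 0 1)"
    by (rule has_contour_integral_eq) (use on_circle in auto)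
  then have "contour_integral (circlepath 0 1) (\<lambda>z. deriv ?H z * cnj (?B z) / z)
      = (2 * of_real pi * \<i>) * (of_nat (Suc j) * 0 ^ j + (\<Sum>l\<leftarrow>ls. l ^ j))"
    by (subst contour_integral_unique) (simp_all add: sum_list_const_mult algebra_simps)
  then show ?thesis
    using circle_mult_cnj_sums[OF holomorphic_deriv[OF H open_ball] B R(1)]
    by (simp add: coeff mult.assoc add.commute del: of_nat_Suc power_Suc)
qed

text \<open>If all power sums vanish, so does the sum over the list of \<open>q\<close> for every polynomial \<open>q\<close> without constant
  term. Taking \<open>q = z * p\<close>, where \<open>p\<close> vanishes at all entries except \<open>\<mu>\<close>, leaves the multiplicity of
  \<open>\<mu>\<close> times \<open>\<mu> * p \<mu>\<close>.\<close>

lemma power_sums_eq_0_imp_zeros: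
  fixes ls :: "complex list"
  assumes "\<And>j. j \<ge> 1 \<Longrightarrow> (\<Sum>l\<leftarrow>ls. l ^ j) = 0" and \<mu>: "\<mu> \<in> set ls"
  shows "\<mu> = 0"
proof (rule ccontr)
  assume nz: "\<mu> \<noteq> 0"
  define p where "p = (\<Prod>\<nu>\<in>set ls - {\<mu>}. [:- \<nu>, 1:])"
  have p_root: "poly p \<nu> = 0" if "\<nu> \<in> set ls" "\<nu> \<noteq> \<mu>" for \<nu>
    unfolding p_def poly_prod using that by (intro prod_zero) auto
  have p_\<mu>: "poly p \<mu> \<noteq> 0"
    unfolding p_def poly_prod by (subst prod_zero_iff) auto
  have moment: "(\<Sum>l\<leftarrow>ls. l ^ Suc i * poly q l) = 0" for q i
  proof (induction q arbitrary: i)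
    case (pCons a q)
    have "(\<Sum>l\<leftarrow>ls. l ^ Suc i * poly (pCons a q) l) =
        (\<Sum>l\<leftarrow>ls. a * l ^ Suc i) + (\<Sum>l\<leftarrow>ls. l ^ Suc (Suc i) * poly q l)"
      by (simp add: sum_list_addf[symmetric] algebra_simps)
    also have "\<dots> = 0"
      using assms(1)[of "Suc i"] pCons.IH[of "Suc i"] by (simp only: sum_list_const_mult) simp
    finally show ?case .
  qed simp
  have "(\<Sum>l\<leftarrow>xs. l ^ Suc 0 * poly p l) = of_nat (count_list xs \<mu>) * (\<mu> * poly p \<mu>)"
    if "set xs \<subseteq> set ls" for xs
    using that by (induction xs) (auto simp: p_root algebra_simps)
  from this[of ls] moment[of 0 p] have "of_nat (count_list ls \<mu>) * (\<mu> * poly p \<mu>) = 0"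
    by simp
  then show False using nz p_\<mu> \<mu> by (simp add: count_list_0_iff)
qed

section \<open>Equivalence with the power forces all zeros to be 0\<close>

text \<open>Elements of the Dirichlet space vanish off the disc, so functions given by a formula enter it
  through this cut-off.\<close>

definition restrict_disc :: "(complex \<Rightarrow> complex) \<Rightarrow> complex \<Rightarrow> complex" where
  "restrict_disc h z = (if z \<in> unit_disc then h z else 0)"

lemma taylor_coeff_restrict_disc:
  assumes "h holomorphic_on unit_disc"
  shows "taylor_coeff (restrict_disc h) = taylor_coeff h"
  by (rule taylor_coeff_cong[OF zero_less_one assms]) (simp add: restrict_disc_def)

text \<open>Holomorphy across the unit circle makes \<open>\<Sum>k. k * \<bar>h\<^sub>k\<bar>\<close> converge, and eventually \<open>\<bar>h\<^sub>k\<bar>\<^sup>2 \<le> \<bar>h\<^sub>k\<bar>\<close>.\<close>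

lemma restrict_disc_in_dirichlet_space:
  assumes h: "h holomorphic_on ball 0 R" and R: "R > 1"
  shows "restrict_disc h \<in> dirichlet_space"
proof -
  have h1: "h holomorphic_on unit_disc"
    using h R by (auto elim: holomorphic_on_subset)
  have "summable (\<lambda>k. cmod (taylor_coeff (deriv h) k) * 1 ^ k)"
    by (rule summable_norm_taylor_coeff[OF holomorphic_deriv[OF h]]) (use R in auto)
  then have "summable (\<lambda>k. real (Suc k) * cmod (taylor_coeff h (Suc k)))"
    by (simp add: taylor_coeff_deriv norm_mult del: of_nat_Suc)
  then have deriv_summable: "summable (\<lambda>k. real k * cmod (taylor_coeff h k))"
    by (subst (asm) summable_Suc_iff)
  have "summable (\<lambda>k. cmod (taylor_coeff h k) * 1 ^ k)"
    by (rule summable_norm_taylor_coeff[OF h]) (use R in auto)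
  then have "(\<lambda>k. cmod (taylor_coeff h k)) \<longlonglongrightarrow> 0"
    using summable_LIMSEQ_zero by simp
  then have "eventually (\<lambda>k. cmod (taylor_coeff h k) < 1) sequentially"
    by (rule order_tendstoD) simp
  then have "eventually (\<lambda>k. norm (real k * (cmod (taylor_coeff h k))\<^sup>2) \<le> real k * cmod (taylor_coeff h k)) sequentially"
    by eventually_elim (auto simp: power2_eq_square intro!: mult_left_mono mult_left_le)
  then have "summable (\<lambda>k. real k * (cmod (taylor_coeff h k))\<^sup>2)"
    by (rule summable_comparison_test_ev[OF _ deriv_summable])
  moreover have "restrict_disc h holomorphic_on unit_disc"
    by (rule holomorphic_transform[OF h1]) (simp add: restrict_disc_def)
  ultimately show ?thesis
    by (simp add: dirichlet_space_iff_summable taylor_coeff_restrict_disc[OF h1])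
       (simp add: restrict_disc_def)
qed

text \<open>Multiplication by \<open>z ^ n\<close> shifts the coefficients, so it raises each weight by \<open>n\<close>.\<close>

lemma dirichlet_inner_power_mult_sums:
  assumes f: "f \<in> dirichlet_space" and g: "g \<in> dirichlet_space"
    and f': "mult_op (\<lambda>z. z ^ n) f \<in> dirichlet_space" and g': "mult_op (\<lambda>z. z ^ n) g \<in> dirichlet_space"
  shows "(\<lambda>k. of_nat (Suc k + n) * (taylor_coeff f k * cnj (taylor_coeff g k))) sums
    dirichlet_inner (mult_op (\<lambda>z. z ^ n) f) (mult_op (\<lambda>z. z ^ n) g)"
proof -
  have hol: "f holomorphic_on unit_disc" "g holomorphic_on unit_disc"
    using f g by (auto simp: dirichlet_space_def)
  show ?thesis
    using dirichlet_inner_sums[OF f' g']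
    by (subst (asm) sums_zero_iff_shift[symmetric, where n = n])
       (simp_all add: mult_op_def taylor_coeff_power_mult hol add_ac)
qed

lemma taylor_coeff_monomial: "taylor_coeff (\<lambda>z. z ^ j) k = (if k = j then 1 else 0)"
proof -
  have "taylor_coeff (\<lambda>z. z ^ j) = (\<lambda>k. if k = j then 1 else 0)"
  proof (rule taylor_coeff_eqI[of 1])
    fix z :: complex
    have "(\<lambda>k. if k = j then z ^ k else 0) sums (z ^ j)" by (rule sums_single)
    then show "(\<lambda>k. (if k = j then 1 else 0) * z ^ k) sums (z ^ j)"
      by (simp add: if_distrib[of "\<lambda>x. x * _"] cong: if_cong)
  qed simp
  then show ?thesis by simp
qed

lemma dirichlet_inner_monomials:
  "dirichlet_inner (restrict_disc (\<lambda>z. z ^ i)) (restrict_disc (\<lambda>z. z ^ j)) = (if i = j then of_nat (Suc i) else 0)"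
proof -
  have coeff: "taylor_coeff (restrict_disc (\<lambda>z. z ^ i)) k = (if k = i then 1 else 0)" for i k
    by (subst taylor_coeff_restrict_disc) (auto intro!: holomorphic_intros simp: taylor_coeff_monomial)
  have mem: "restrict_disc (\<lambda>z. z ^ i) \<in> dirichlet_space" for i
    by (rule restrict_disc_in_dirichlet_space[of _ 2]) (auto intro!: holomorphic_intros)
  have "(\<lambda>k. if k = i then (if i = j then of_nat (Suc k) else 0) else 0) sums
      dirichlet_inner (restrict_disc (\<lambda>z. z ^ i)) (restrict_disc (\<lambda>z. z ^ j))"
    using dirichlet_inner_sums[OF mem[of i] mem[of j]]
    by (rule back_subst[of "\<lambda>t. t sums _"]) (auto simp: coeff)
  then show ?thesis
    using sums_single[of i "\<lambda>k. if i = j then of_nat (Suc k) else 0 :: complex"] sums_unique2 by fastforce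
qed

text \<open>The image \<open>g 0\<close> of the constant function 1 under the inverse unitary is itself constant; pairing it with
  the images \<open>g j\<close> of the other monomials shows that the power sums of the zeros vanish.\<close>

lemma finite_blaschke_product_equivalent_imp_power:
  assumes n: "n \<ge> 1" and \<phi>: "finite_blaschke_product n \<phi>"
    and eq: "unitarily_equivalent (mult_op \<phi>) (mult_op (\<lambda>z. z ^ n))"
  shows "\<exists>a. cmod a = 1 \<and> (\<forall>z\<in>unit_disc. \<phi> z = a * z ^ n)"
proof -
  obtain c ls where c: "cmod c = 1" and len: "length ls = n" and ls: "set ls \<subseteq> unit_disc"
    and \<phi>_eq: "\<And>z. z \<in> unit_disc \<Longrightarrow> \<phi> z = blaschke_product c ls z"
    using \<phi> by (auto simp: finite_blaschke_product_def blaschke_product_def)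
  let ?B = "blaschke_product c ls"
  let ?T = "mult_op (\<lambda>z. z ^ n)"
  define e where "e j = restrict_disc (\<lambda>z. z ^ j)" for j
  obtain U U' where adj: "dirichlet_adjoint U U'"
    and UU': "\<And>f. f \<in> dirichlet_space \<Longrightarrow> U (U' f) = f"
    and conj: "\<And>f. f \<in> dirichlet_space \<Longrightarrow> U' (mult_op \<phi> (U f)) = ?T f"
    using eq by (auto simp: unitarily_equivalent_def)
  have U'_mem: "U' f \<in> dirichlet_space" if "f \<in> dirichlet_space" for f
    using adj that by (auto simp: dirichlet_adjoint_def dirichlet_operator_def)
  have U'_isometry: "dirichlet_inner (U' f) (U' g) = dirichlet_inner f g"
    if "f \<in> dirichlet_space" "g \<in> dirichlet_space" for f g
    using adj that U'_mem UU' by (metis dirichlet_adjoint_def)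
  obtain R where R: "R > 1" "\<And>l z. l \<in> set ls \<Longrightarrow> cmod z < R \<Longrightarrow> 1 - cnj l * z \<noteq> 0"
    using obtain_pole_free_radius[OF ls] by metis
  have B: "?B holomorphic_on ball 0 R"
    by (rule blaschke_product_holomorphic) (use R in auto)
  have B1: "?B holomorphic_on unit_disc"
    using B R(1) by (auto elim: holomorphic_on_subset)
  have e_mem: "e j \<in> dirichlet_space" for j
    unfolding e_def by (rule restrict_disc_in_dirichlet_space[of _ 2]) (auto intro!: holomorphic_intros)
  have \<phi>e: "mult_op \<phi> (e j) = restrict_disc (\<lambda>z. z ^ j * ?B z)" for j
    by (auto simp: mult_op_def e_def restrict_disc_def \<phi>_eq)
  have \<phi>e_mem: "mult_op \<phi> (e j) \<in> dirichlet_space" for j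
    unfolding \<phi>e by (rule restrict_disc_in_dirichlet_space[OF _ R(1)]) (intro holomorphic_intros B)
  have \<phi>e_inner: "dirichlet_inner (mult_op \<phi> (e j)) (mult_op \<phi> (e 0)) = of_nat (Suc j) * 0 ^ j + (\<Sum>l\<leftarrow>ls. l ^ j)" for j
  proof -
    have coeff: "taylor_coeff (mult_op \<phi> (e i)) = taylor_coeff (\<lambda>z. z ^ i * ?B z)" for i
      unfolding \<phi>e by (intro taylor_coeff_restrict_disc holomorphic_intros B1)
    have "(\<lambda>k. of_nat (Suc k) * (taylor_coeff (\<lambda>z. z ^ j * ?B z) k * cnj (taylor_coeff ?B k))) sums
        dirichlet_inner (mult_op \<phi> (e j)) (mult_op \<phi> (e 0))"
      using dirichlet_inner_sums[OF \<phi>e_mem[of j] \<phi>e_mem[of 0]] by (simp add: coeff del: of_nat_Suc)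
    then show ?thesis
      by (rule sums_unique2) (rule blaschke_product_inner_sums[OF c ls])
  qed
  define g where "g j = U' (e j)" for j
  have g_mem: "g j \<in> dirichlet_space" for j
    unfolding g_def by (intro U'_mem e_mem)
  \<comment> \<open>Applying the intertwining relation to \<open>g j\<close>, where \<open>U (g j) = e j\<close>.\<close>
  have Tg: "?T (g j) = U' (mult_op \<phi> (e j))" for j
    using conj[OF g_mem[of j]] UU'[OF e_mem[of j]] by (simp add: g_def)
  have Tg_mem: "?T (g j) \<in> dirichlet_space" for j
    unfolding Tg by (intro U'_mem \<phi>e_mem)
  have e_inner: "dirichlet_inner (e j) (e 0) = (if j = 0 then 1 else 0)" for j
    unfolding e_def dirichlet_inner_monomials by simp
  have g_sums: "(\<lambda>k. of_nat (Suc k) * (taylor_coeff (g j) k * cnj (taylor_coeff (g 0) k))) sums (if j = 0 then 1 else 0)" for j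
    using dirichlet_inner_sums[OF g_mem[of j] g_mem[of 0]] U'_isometry[OF e_mem[of j] e_mem[of 0]]
    by (simp only: g_def e_inner)
  have Tg_sums: "(\<lambda>k. of_nat (Suc k + n) * (taylor_coeff (g j) k * cnj (taylor_coeff (g 0) k))) sums
      (of_nat (Suc j) * 0 ^ j + (\<Sum>l\<leftarrow>ls. l ^ j))" for j
    using dirichlet_inner_power_mult_sums[OF g_mem[of j] g_mem[of 0] Tg_mem Tg_mem]
      U'_isometry[OF \<phi>e_mem[of j] \<phi>e_mem[of 0]] \<phi>e_inner[of j]
    by (simp only: Tg)
  have g0_const: "taylor_coeff (g 0) k = 0" if "k \<ge> 1" for k
  proof -
    let ?a = "\<lambda>k. taylor_coeff (g 0) k"
    \<comment> \<open>With \<open>(n + 1) * (k + 1) - (k + 1 + n) = n * k\<close>, the two norm identities combine to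
      \<open>\<Sum>k. n * k * \<bar>a\<^sub>k\<bar>\<^sup>2 = 0\<close>.\<close>
    have "(\<lambda>k. of_nat (Suc n) * (of_nat (Suc k) * (?a k * cnj (?a k))) - of_nat (Suc k + n) * (?a k * cnj (?a k))) sums
        (of_nat (Suc n) * 1 - (of_nat (Suc 0) * 0 ^ 0 + (\<Sum>l\<leftarrow>ls. l ^ 0)))"
      using g_sums[of 0] Tg_sums[of 0] by (intro sums_diff sums_mult) auto
    also have "(\<lambda>k. of_nat (Suc n) * (of_nat (Suc k) * (?a k * cnj (?a k))) - of_nat (Suc k + n) * (?a k * cnj (?a k)))
        = (\<lambda>k. complex_of_real (real (n * k) * (cmod (?a k))\<^sup>2))"
      by (rule ext, simp only: complex_norm_square[symmetric]) (simp add: algebra_simps)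
    also have "of_nat (Suc n) * 1 - (of_nat (Suc 0) * 0 ^ 0 + (\<Sum>l\<leftarrow>ls. l ^ 0)) = complex_of_real 0"
      using len by (simp add: sum_list_triv)
    finally have s: "(\<lambda>k. real (n * k) * (cmod (?a k))\<^sup>2) sums 0"
      by (simp only: sums_of_real_iff)
    then have "real (n * k) * (cmod (?a k))\<^sup>2 = 0"
      using suminf_eq_zero_iff[of "\<lambda>k. real (n * k) * (cmod (?a k))\<^sup>2"] by (auto simp: sums_iff)
    then show ?thesis using that n by auto
  qed
  have "(\<Sum>l\<leftarrow>ls. l ^ j) = 0" if j: "j \<ge> 1" for j
  proof -
    let ?p = "taylor_coeff (g j) 0 * cnj (taylor_coeff (g 0) 0)"
    \<comment> \<open>Since \<open>g 0\<close> is constant, both inner products reduce to their term at \<open>k = 0\<close>, so the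
      vanishing of one forces that of the other.\<close>
    have single: "(\<lambda>k. c k * (taylor_coeff (g j) k * cnj (taylor_coeff (g 0) k))) sums (c 0 * ?p)" for c :: "nat \<Rightarrow> complex"
    proof -
      have "(\<lambda>k. c k * (taylor_coeff (g j) k * cnj (taylor_coeff (g 0) k))) sums
          (\<Sum>k\<in>{0}. c k * (taylor_coeff (g j) k * cnj (taylor_coeff (g 0) k)))"
        using g0_const by (intro sums_finite) auto
      then show ?thesis by simp
    qed
    have p: "?p = 0"
      using sums_unique2[OF single g_sums[of j]] j by simp
    then show ?thesis
      using sums_unique2[OF single Tg_sums[of j]] j unfolding p by (simp add: zero_power)
  qed
  then have zero: "l = 0" if "l \<in> set ls" for l
    using power_sums_eq_0_imp_zeros that by blast
  have "ls = replicate n 0"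
    using zero len by (simp add: list_eq_iff_nth_eq)
  then have "\<phi> z = (c * (- 1) ^ n) * z ^ n" if "z \<in> unit_disc" for z
    using \<phi>_eq[OF that]
    by (simp add: blaschke_product_def blaschke_factor_def map_replicate_const prod_list_replicate power_minus[of z])
  moreover have "cmod (c * (- 1) ^ n) = 1" using c by (simp add: norm_mult norm_power)
  ultimately show ?thesis by blast
qed

section \<open>Rotations as unitary operators\<close>

definition rotate_arg :: "complex \<Rightarrow> (complex \<Rightarrow> complex) \<Rightarrow> complex \<Rightarrow> complex" where
  "rotate_arg w f z = f (w * z)"

lemma taylor_coeff_rotate_arg:
  assumes "f holomorphic_on unit_disc" "cmod w = 1"
  shows "taylor_coeff (rotate_arg w f) k = w ^ k * taylor_coeff f k"
proof -
  have "taylor_coeff (rotate_arg w f) = (\<lambda>k. w ^ k * taylor_coeff f k)"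
  proof (rule taylor_coeff_eqI[of 1])
    fix z :: complex assume "cmod z < 1"
    then have "(\<lambda>k. taylor_coeff f k * (w * z) ^ k) sums f (w * z)"
      using assms(2) by (intro taylor_coeff_sums[OF assms(1)]) (simp add: norm_mult)
    then show "(\<lambda>k. w ^ k * taylor_coeff f k * z ^ k) sums rotate_arg w f z"
      by (simp add: rotate_arg_def power_mult_distrib mult_ac)
  qed simp
  then show ?thesis by simp
qed

lemma rotate_arg_in_dirichlet_space:
  assumes f: "f \<in> dirichlet_space" and w: "cmod w = 1"
  shows "rotate_arg w f \<in> dirichlet_space"
proof -
  have hol: "f holomorphic_on unit_disc" using f by (simp add: dirichlet_space_def)
  have "(f \<circ> (\<lambda>z. w * z)) holomorphic_on unit_disc"
    by (rule holomorphic_on_compose_gen[OF _ hol]) (use w in \<open>auto simp: norm_mult intro!: holomorphic_intros\<close>)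
  then have "rotate_arg w f holomorphic_on unit_disc"
    by (simp add: o_def rotate_arg_def[abs_def])
  then show ?thesis
    using f w by (simp add: dirichlet_space_iff_summable taylor_coeff_rotate_arg norm_mult norm_power)
      (simp add: rotate_arg_def norm_mult)
qed

lemma dirichlet_inner_rotate_arg:
  assumes f: "f \<in> dirichlet_space" and g: "g \<in> dirichlet_space" and w: "cmod w = 1"
  shows "dirichlet_inner (rotate_arg w f) g = dirichlet_inner f (rotate_arg (cnj w) g)"
proof -
  have hol: "f holomorphic_on unit_disc" "g holomorphic_on unit_disc"
    using f g by (auto simp: dirichlet_space_def)
  have w': "cmod (cnj w) = 1" using w by simp
  show ?thesis
    using dirichlet_inner_sums[OF rotate_arg_in_dirichlet_space[OF f w] g]
      dirichlet_inner_sums[OF f rotate_arg_in_dirichlet_space[OF g w']]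
    by (simp add: taylor_coeff_rotate_arg[OF hol(1) w] taylor_coeff_rotate_arg[OF hol(2) w'] mult_ac sums_unique2)
qed

lemma rotate_arg_inverse:
  assumes "cmod w = 1"
  shows "rotate_arg (cnj w) (rotate_arg w f) = f" "rotate_arg w (rotate_arg (cnj w) f) = f"
proof -
  have cancel: "w * (cnj w * z) = z" "cnj w * (w * z) = z" for z
    using assms by (simp_all add: mult.assoc[symmetric] complex_norm_square[symmetric] mult.commute[of "cnj w"])
  then show "rotate_arg (cnj w) (rotate_arg w f) = f" "rotate_arg w (rotate_arg (cnj w) f) = f"
    by (simp_all only: rotate_arg_def fun_eq_iff cancel simp_thms)
qed

lemma dirichlet_operator_rotate_arg:
  assumes w: "cmod w = 1"
  shows "dirichlet_operator (rotate_arg w)"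
proof -
  have w': "cmod (cnj w) = 1" using w by simp
  have "dirichlet_inner (rotate_arg w f) (rotate_arg w f) = dirichlet_inner f f" if "f \<in> dirichlet_space" for f
    using dirichlet_inner_rotate_arg[OF that rotate_arg_in_dirichlet_space[OF that w] w]
    by (simp add: rotate_arg_inverse[OF w])
  then have "\<exists>K. \<forall>f\<in>dirichlet_space. dirichlet_norm (rotate_arg w f) \<le> K * dirichlet_norm f"
    by (intro exI[of _ 1]) (simp add: dirichlet_norm_def)
  then show ?thesis
    using rotate_arg_in_dirichlet_space w by (auto simp: dirichlet_operator_def rotate_arg_def)
qed

text \<open>With \<open>a = w ^ n\<close>, the rotation by \<open>w\<close> conjugates multiplication by \<open>a * z ^ n\<close> into multiplication
  by \<open>z ^ n\<close>.\<close>

lemma power_imp_unitarily_equivalent: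
  assumes n: "n \<ge> 1" and a: "cmod a = 1" and \<phi>: "\<And>z. z \<in> unit_disc \<Longrightarrow> \<phi> z = a * z ^ n"
  shows "unitarily_equivalent (mult_op \<phi>) (mult_op (\<lambda>z. z ^ n))"
proof -
  obtain w where w: "a = w ^ n"
    using exists_complex_root[of n a] n by auto
  have "cmod w ^ n = 1" using a w by (simp add: norm_power)
  then have w1: "cmod w = 1"
    using n power_eq_1_iff by (metis norm_ge_zero not_one_le_zero real_norm_def abs_of_nonneg)
  have w1': "cmod (cnj w) = 1" using w1 by simp
  have "rotate_arg (cnj w) (mult_op \<phi> (rotate_arg w f)) = mult_op (\<lambda>z. z ^ n) f"
    if f: "f \<in> dirichlet_space" for f
  proof
    fix z
    have ww: "w * cnj w = 1" using w1 by (simp add: complex_norm_square[symmetric])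
    have cancel: "rotate_arg w f (cnj w * z) = f z"
      using ww by (simp add: rotate_arg_def mult.assoc[symmetric])
    show "rotate_arg (cnj w) (mult_op \<phi> (rotate_arg w f)) z = mult_op (\<lambda>z. z ^ n) f z"
    proof (cases "z \<in> unit_disc")
      case True
      then have "\<phi> (cnj w * z) = (w * cnj w) ^ n * z ^ n"
        using w1 by (subst \<phi>) (auto simp: norm_mult w power_mult_distrib)
      then show ?thesis
        unfolding mult_op_def rotate_arg_def[of "cnj w"] cancel by (simp add: ww)
    next
      case False
      then have "f z = 0" using f by (simp add: dirichlet_space_def)
      then show ?thesis
        unfolding mult_op_def rotate_arg_def[of "cnj w"] cancel by simp
    qed
  qed
  moreover have "dirichlet_adjoint (rotate_arg w) (rotate_arg (cnj w))"
    using dirichlet_operator_rotate_arg[OF w1] dirichlet_operator_rotate_arg[OF w1']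
      dirichlet_inner_rotate_arg w1 by (auto simp: dirichlet_adjoint_def)
  ultimately show ?thesis
    using rotate_arg_inverse[OF w1] unfolding unitarily_equivalent_def by blast
qed

theorem theorem1p4:
  fixes \<phi> :: "complex \<Rightarrow> complex" and n :: nat
  assumes "n > 1" and "finite_blaschke_product n \<phi>"
  shows "unitarily_equivalent (mult_op \<phi>) (mult_op (\<lambda>z. z ^ n)) \<longleftrightarrow>
    (\<exists>a. cmod a = 1 \<and> (\<forall>z\<in>unit_disc. \<phi> z = a * z ^ n))"
  using assms finite_blaschke_product_equivalent_imp_power[of n \<phi>] power_imp_unitarily_equivalent[of n _ \<phi>]
  by auto

end
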